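(* Let $D=D_1\times\cdots\times D_k$ with each $D_j\subset\mathbb{C}^{n_j}$ a bounded domain, let $p\in(1,\infty)$, and suppose $T:L^p_{(0,1)}(D_1)\to L^p(D_1)$ is a bounded linear operator that solves the $\bar\partial_1$-equation on $D_1$. Assume there exists a bounded linear operator $P:L^p(D_1)\to A^p(D_1)$ which preserves $A^p(D_1)$ (i.e. $Ph=h$ for all $h\in A^p(D_1)$). Then $S=T-P\circ T$ satisfies $\big[\partial/\partial\bm{\bar z}_*,S\big]=0$, where $\partial/\partial\bm{\bar z}_*$ denotes an arbitrary barred derivative in the variables on $D_2\times\cdots\times D_k$.
   Context: $A^p(D_1)=L^p(D_1)\cap\mathcal{O}(D_1)$, where $\mathcal{O}(D_1)$ is the space of holomorphic functions on $D_1$. $L^p_{(0,1)}$ denotes $(0,1)$-forms with $L^p$ coefficients, and $\bar\partial_1$ is the Cauchy-Riemann operator in the variables of $D_1$. "$T$ solves the $\bar\partial_1$-equation on $D_1$" means $\bar\partial_1(T\alpha)=\alpha$ weakly for every $\alpha\in L^p_{(0,1)}(D_1)$ with $\bar\partial_1\alpha=0$ weakly. $T$, $P$ and $S$ act on functions or forms $g=\sum_m g_m\,d\bar z^1_m$ (where $z^1_1,\dots,z^1_{n_1}$ are the coordinates on $D_1$) with coefficients in $L^p(D)$ by treating the variables on $D_2\times\cdots\times D_k$ as parameters. The commutator identity $[\partial/\partial\bm{\bar z}_*,S]=0$ means: for every such form $g$ with $g$ and $\partial g/\partial\bm{\bar z}_*$ having coefficients in $L^p(D)$ (distributional derivative of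 the coefficients) and $\bar\partial_1 g=0$ weakly, one has $\frac{\partial}{\partial\bm{\bar z}_*}S(g)=S\big(\frac{\partial g}{\partial\bm{\bar z}_*}\big)$. A barred derivative is a single $\partial/\partial\bar z$ with respect to one of the complex coordinates. *)

theory Defs
  imports "HOL-Analysis.Analysis"
begin

section \<open>Domains\<close>

text \<open>A domain is taken relative to a linear subspace \<open>V\<close>; \<open>V = UNIV\<close> is the usual case.\<close>

definition bounded_domain_in :: "'a::euclidean_space set \<Rightarrow> 'a set \<Rightarrow> bool" where
  "bounded_domain_in V U \<longleftrightarrow>
     U \<noteq> {} \<and> openin (top_of_set V) U \<and> connected U \<and> bounded U"

text \<open>
  Spaces of varying dimension \<open>n\<^sub>j\<close>: a map \<open>blk\<close> assigns to every coordinate index the number of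
  the factor it belongs to.  The factor with number \<open>j\<close> is the coordinate subspace
  \<open>block_space blk j\<close>, isometric to complex \<open>n\<^sub>j\<close>-space where \<open>n\<^sub>j\<close> is the number of
  indices \<open>i\<close> with \<open>blk i = j\<close>; \<open>block_proj\<close> is the projection of the whole space onto it.
\<close>

definition block_space :: "('m::finite \<Rightarrow> nat) \<Rightarrow> nat \<Rightarrow> (complex^'m) set" where
  "block_space blk j = {w. \<forall>i. blk i \<noteq> j \<longrightarrow> w $ i = 0}"

definition block_proj :: "('m::finite \<Rightarrow> nat) \<Rightarrow> nat \<Rightarrow> complex^'m \<Rightarrow> complex^'m" where
  "block_proj blk j w = (\<chi> i. if blk i = j then w $ i else 0)"

definition block_product ::
    "('m::finite \<Rightarrow> nat) \<Rightarrow> nat set \<Rightarrow> (nat \<Rightarrow> (complex^'m) set) \<Rightarrow> (complex^'m) set" where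
  "block_product blk J Ds = {w. \<forall>j\<in>J. block_proj blk j w \<in> Ds j}"


section \<open>\<open>L\<^sup>p\<close> spaces\<close>

text \<open>
  An element of \<open>L\<^sup>p\<close> is represented by a Borel function, two representatives being identified
  when they agree almost everywhere on \<open>U\<close> (every Lebesgue measurable function has a Borel
  representative).  Values outside \<open>U\<close> are irrelevant.
\<close>

abbreviation vol :: "'a::euclidean_space set \<Rightarrow> 'a measure" where
  "vol U \<equiv> restrict_space lborel U"

definition ae_eq :: "'a::euclidean_space set \<Rightarrow> ('a \<Rightarrow> 'b) \<Rightarrow> ('a \<Rightarrow> 'b) \<Rightarrow> bool" where
  "ae_eq U f g \<longleftrightarrow> (AE z in vol U. f z = g z)"

definition lp :: "real \<Rightarrow> 'a::euclidean_space set \<Rightarrow> ('a \<Rightarrow> complex) set" where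
  "lp p U = {f \<in> borel_measurable (vol U). integrable (vol U) (\<lambda>z. norm (f z) powr p)}"

definition lp_norm :: "real \<Rightarrow> 'a::euclidean_space set \<Rightarrow> ('a \<Rightarrow> 'b::real_normed_vector) \<Rightarrow> real" where
  "lp_norm p U f = (LINT z|vol U. norm (f z) powr p) powr (1 / p)"

text \<open>
  The form with coefficients \<open>g\<^sub>m\<close> with respect to the differentials of the conjugate coordinates
  is represented by the vector valued function with components \<open>g\<^sub>m\<close>.
\<close>

definition lp_form :: "real \<Rightarrow> 'a::euclidean_space set \<Rightarrow> ('a \<Rightarrow> complex^'n) set" where
  "lp_form p U = {g. \<forall>m. (\<lambda>z. g z $ m) \<in> lp p U}"

text \<open>
  Bounded complex linear operators from \<open>X\<close> to \<open>L\<^sup>p\<close>, given on representatives; \<open>smul\<close> is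
  multiplication of values by complex scalars.
\<close>

definition bounded_lp_operator ::
    "real \<Rightarrow> 'a::euclidean_space set \<Rightarrow> ('a \<Rightarrow> 'b::real_normed_vector) set \<Rightarrow>
     (complex \<Rightarrow> 'b \<Rightarrow> 'b) \<Rightarrow> (('a \<Rightarrow> 'b) \<Rightarrow> 'a \<Rightarrow> complex) \<Rightarrow> bool" where
  "bounded_lp_operator p U X smul T \<longleftrightarrow>
     (\<forall>f\<in>X. T f \<in> lp p U) \<and>
     (\<forall>f\<in>X. \<forall>g\<in>X. ae_eq U f g \<longrightarrow> ae_eq U (T f) (T g)) \<and>
     (\<forall>f\<in>X. \<forall>g\<in>X. ae_eq U (T (\<lambda>z. f z + g z)) (\<lambda>z. T f z + T g z)) \<and>
     (\<forall>c. \<forall>f\<in>X. ae_eq U (T (\<lambda>z. smul c (f z))) (\<lambda>z. c * T f z)) \<and>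
     (\<exists>C. \<forall>f\<in>X. lp_norm p U (T f) \<le> C * lp_norm p U f)"


section \<open>Bergman space\<close>

definition holomorphic_several :: "(complex^'n \<Rightarrow> complex) \<Rightarrow> (complex^'n) set \<Rightarrow> bool" where
  "holomorphic_several h U \<longleftrightarrow>
     (\<forall>z\<in>U. \<exists>h'. (h has_derivative h') (at z) \<and> (\<forall>c v. h' (c *s v) = c * h' v))"

text \<open>As a subspace of \<open>L\<^sup>p\<close>: the classes that contain a function holomorphic on \<open>U\<close>.\<close>

definition bergman :: "real \<Rightarrow> (complex^'n) set \<Rightarrow> (complex^'n \<Rightarrow> complex) set" where
  "bergman p U = {f \<in> lp p U. \<exists>h. holomorphic_several h U \<and> ae_eq U f h}"


section \<open>Weak barred derivatives\<close>

text \<open>\<open>ck k f\<close>: \<open>f\<close> is of class \<open>C\<^sup>k\<close> on the whole space.\<close>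

fun ck :: "nat \<Rightarrow> ('a::euclidean_space \<Rightarrow> complex) \<Rightarrow> bool" where
  "ck 0 f \<longleftrightarrow> continuous_on UNIV f"
| "ck (Suc k) f \<longleftrightarrow>
     (\<exists>f'. (\<forall>x. (f has_derivative f' x) (at x)) \<and> (\<forall>v. ck k (\<lambda>x. f' x v)))"

definition test_function :: "'a::euclidean_space set \<Rightarrow> ('a \<Rightarrow> complex) \<Rightarrow> bool" where
  "test_function U \<phi> \<longleftrightarrow>
     (\<forall>k. ck k \<phi>) \<and> (\<exists>K. compact K \<and> K \<subseteq> U \<and> (\<forall>x. x \<notin> K \<longrightarrow> \<phi> x = 0))"

text \<open>
  The derivative with respect to the conjugate of one complex coordinate, i.e. half the sum of the
  partial derivative in the real direction and \<open>\<i>\<close> times that in the imaginary direction.  The coordinate is given by the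
  embedding \<open>\<iota>\<close> of its complex axis into the space.
\<close>

definition dbar :: "(complex \<Rightarrow> 'a::euclidean_space) \<Rightarrow> ('a \<Rightarrow> complex) \<Rightarrow> 'a \<Rightarrow> complex" where
  "dbar \<iota> \<phi> z =
     (frechet_derivative \<phi> (at z) (\<iota> 1) + \<i> * frechet_derivative \<phi> (at z) (\<iota> \<i>)) / 2"

definition weak_dbar ::
    "'a::euclidean_space set \<Rightarrow> (complex \<Rightarrow> 'a) \<Rightarrow> ('a \<Rightarrow> complex) \<Rightarrow> ('a \<Rightarrow> complex) \<Rightarrow> bool" where
  "weak_dbar U \<iota> u w \<longleftrightarrow>
     (\<forall>\<phi>. test_function U \<phi> \<longrightarrow>
        (LINT z|vol U. u z * dbar \<iota> \<phi> z) = - (LINT z|vol U. w z * \<phi> z))"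

text \<open>
  Weak closedness of the form with coefficients \<open>\<alpha>\<^sub>m\<close>: for all \<open>l\<close> and \<open>m\<close> the distributional
  derivatives of \<open>\<alpha>\<^sub>m\<close> in the conjugate of the \<open>l\<close>-th coordinate and of \<open>\<alpha>\<^sub>l\<close> in the conjugate
  of the \<open>m\<close>-th one coincide.  Here \<open>\<iota> m\<close> is the \<open>m\<close>-th complex axis.
\<close>

definition weakly_closed ::
    "'a::euclidean_space set \<Rightarrow> ('n \<Rightarrow> complex \<Rightarrow> 'a) \<Rightarrow> ('a \<Rightarrow> complex^'n) \<Rightarrow> bool" where
  "weakly_closed U \<iota> \<alpha> \<longleftrightarrow>
     (\<forall>l m. \<forall>\<phi>. test_function U \<phi> \<longrightarrow>
        (LINT z|vol U. \<alpha> z $ m * dbar (\<iota> l) \<phi> z) = (LINT z|vol U. \<alpha> z $ l * dbar (\<iota> m) \<phi> z))"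

definition solves_dbar ::
    "real \<Rightarrow> (complex^'n) set \<Rightarrow> ((complex^'n \<Rightarrow> complex^'n) \<Rightarrow> complex^'n \<Rightarrow> complex) \<Rightarrow> bool" where
  "solves_dbar p U T \<longleftrightarrow>
     (\<forall>\<alpha>\<in>lp_form p U. weakly_closed U axis \<alpha> \<longrightarrow>
        (\<forall>m. weak_dbar U (axis m) (T \<alpha>) (\<lambda>z. \<alpha> z $ m)))"


section \<open>Operators acting with parameters\<close>

text \<open>
  \<open>u\<close> represents the element of \<open>L\<^sup>p(U \<times> V)\<close> obtained by applying \<open>S\<close> to \<open>g\<close> in the first
  variable, the second one being a parameter.  The condition that almost every slice of \<open>g\<close> has
  coefficients in \<open>L\<^sup>p(U)\<close> follows by Fubini when \<open>g\<close> has coefficients in \<open>L\<^sup>p(U \<times> V)\<close>.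
  Since \<open>S\<close> only determines the slices of \<open>u\<close> up to null sets, a jointly measurable \<open>u\<close> has to
  be chosen; it is unique up to null sets.
\<close>

definition acts_fibrewise ::
    "real \<Rightarrow> (complex^'n) set \<Rightarrow> (complex^'m) set \<Rightarrow>
     ((complex^'n \<Rightarrow> complex^'n) \<Rightarrow> complex^'n \<Rightarrow> complex) \<Rightarrow>
     ((complex^'n) \<times> (complex^'m) \<Rightarrow> complex^'n) \<Rightarrow>
     ((complex^'n) \<times> (complex^'m) \<Rightarrow> complex) \<Rightarrow> bool" where
  "acts_fibrewise p U V S g u \<longleftrightarrow>
     u \<in> lp p (U \<times> V) \<and>
     (AE w in vol V. (\<lambda>z. g (z, w)) \<in> lp_form p U \<and>
        ae_eq U (\<lambda>z. u (z, w)) (S (\<lambda>z. g (z, w))))"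

text \<open>
  Vanishing of the commutator of \<open>S\<close> with the barred derivative in the \<open>i\<close>-th parameter; \<open>g'\<close> is
  the coefficientwise derivative of \<open>g\<close>.  That \<open>S(g)\<close> and \<open>S(g')\<close> exist is part of the claim.
\<close>

definition commutes_with_dbar ::
    "real \<Rightarrow> (complex^'n) set \<Rightarrow> (complex^'m) set \<Rightarrow> 'm \<Rightarrow>
     ((complex^'n \<Rightarrow> complex^'n) \<Rightarrow> complex^'n \<Rightarrow> complex) \<Rightarrow> bool" where
  "commutes_with_dbar p U V i S \<longleftrightarrow>
     (\<forall>g\<in>lp_form p (U \<times> V). \<forall>g'\<in>lp_form p (U \<times> V).
        (\<forall>m. weak_dbar (U \<times> V) (\<lambda>c. (0, axis i c)) (\<lambda>x. g x $ m) (\<lambda>x. g' x $ m)) \<and>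
        weakly_closed (U \<times> V) (\<lambda>m c. (axis m c, 0)) g \<longrightarrow>
        (\<exists>u. acts_fibrewise p U V S g u) \<and> (\<exists>v. acts_fibrewise p U V S g' v) \<and>
        (\<forall>u v. acts_fibrewise p U V S g u \<and> acts_fibrewise p U V S g' v \<longrightarrow>
           weak_dbar (U \<times> V) (\<lambda>c. (0, axis i c)) u v))"

end

theory Submission
  imports Defs
begin

text \<open>
  A bounded linear operator \<open>S\<close> on \<open>L\<^sup>p(U)\<close> that acts with parameters in \<open>V\<close> commutes with
  integration against bounded weights on \<open>V\<close>; this is clear for indicators of rectangles and
  passes to all of \<open>L\<^sup>p(U \<times> V)\<close> by density.  Testing \<open>\<partial>g/\<partial>w = g'\<close> (barred derivatives) against
  tensor products \<open>\<psi>(z) \<eta>(w)\<close> gives \<open>\<integral> g \<partial>\<eta> dw = - \<integral> g' \<eta> dw\<close> for almost every \<open>z\<close>, and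
  applying \<open>S\<close> yields the same identity for \<open>S g\<close> and \<open>S g'\<close>.  No regularity of the test
  function in \<open>z\<close> is needed beyond continuity, so general test functions are reached by freezing
  \<open>z\<close> at points of a countable dense set.
\<close>

section \<open>Integrals of \<open>p\<close>-th powers\<close>

text \<open>Applying \<open>S\<close> slice by slice prescribes the result, for each parameter, only
  up to a null set belonging to that parameter. Existence of a jointly measurable \<open>S g\<close>
  is therefore something to prove, and it is bundled with the commutation property: the same
  approximation carries both from rectangles to all of \<open>L\<^sup>p\<close>, the limit being
  supplied by completeness. Estimates are made for the integral of the p-th power as an extended
  nonnegative number, with the crude factor \<open>2 powr p\<close> in place of the triangle
  inequality; only convergence to 0 and vanishing are ever read off, so the size of constants does
  not matter. The identity obtained after averaging holds outside a null set of z that depends on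
  the weight. Only countably many weights can thus be treated at once, and this is the obstacle that
  the countable dense set removes. Operators on forms are split into scalar ones, h being sent to
  \<open>S\<close> of the form whose m-th coefficient is h and whose other coefficients are
  0.\<close>

lemma norm_add_powr_le:
  fixes x y :: "'a::real_normed_vector"
  assumes "0 \<le> p"
  shows "norm (x + y) powr p \<le> 2 powr p * (norm x powr p + norm y powr p)"
proof -
  have "norm (x + y) \<le> 2 * max (norm x) (norm y)"
    using norm_triangle_ineq[of x y] by linarith
  then have "norm (x + y) powr p \<le> (2 * max (norm x) (norm y)) powr p"
    using assms by (intro powr_mono2) auto
  also have "\<dots> = 2 powr p * max (norm x) (norm y) powr p"
    by (simp add: powr_mult)
  also have "max (norm x) (norm y) powr p \<le> norm x powr p + norm y powr p"
    by (simp add: max_def)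
  finally show ?thesis by simp
qed

lemma ennreal_tendsto_0I:
  fixes f :: "'a \<Rightarrow> ennreal"
  assumes "\<And>e::real. 0 < e \<Longrightarrow> \<forall>\<^sub>F x in F. f x \<le> ennreal e"
  shows "(f \<longlongrightarrow> 0) F"
proof (rule order_tendstoI)
  fix a :: ennreal assume "0 < a"
  then obtain b where b: "0 < b" "b < a" using dense by blast
  then obtain e where e: "b = ennreal e" "0 \<le> e" by (cases b) auto
  with b have "0 < e" by (simp add: ennreal_less_zero_iff)
  show "\<forall>\<^sub>F x in F. f x < a"
    using assms[OF \<open>0 < e\<close>] by eventually_elim (use b e in auto)
qed simp

text \<open>This is the p-th power of the \<open>L\<^sup>p\<close> norm, taken in [0, \<infinity>]
  so that estimates can be stated before membership in \<open>L\<^sup>p\<close> is known. The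
  measure is arbitrary because slices and products are both integrated.\<close>

definition pint :: "real \<Rightarrow> 'a measure \<Rightarrow> ('a \<Rightarrow> 'b::real_normed_vector) \<Rightarrow> ennreal" where
  "pint p M f = (\<integral>\<^sup>+x. ennreal (norm (f x) powr p) \<partial>M)"

definition Lp :: "real \<Rightarrow> 'a measure \<Rightarrow> ('a \<Rightarrow> complex) set" where
  "Lp p M = {f \<in> borel_measurable M. pint p M f < \<infinity>}"

lemma Lp_measurable[dest]: "f \<in> Lp p M \<Longrightarrow> f \<in> borel_measurable M"
  by (simp add: Lp_def)

lemma pint_mono_AE:
  assumes "0 \<le> p" "AE x in M. norm (f x) \<le> norm (g x)"
  shows "pint p M f \<le> pint p M g"
  unfolding pint_def using assms(2)
  by (intro nn_integral_mono_AE) (auto intro!: ennreal_leI powr_mono2 assms(1) elim!: eventually_mono)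

lemma pint_cong_AE:
  assumes "AE x in M. f x = g x"
  shows "pint p M f = pint p M g"
  unfolding pint_def using assms by (intro nn_integral_cong_AE) (auto elim!: eventually_mono)

lemma pint_eq_0_iff:
  fixes f :: "'a \<Rightarrow> 'b::{real_normed_vector,second_countable_topology}"
  assumes [measurable]: "f \<in> borel_measurable M"
  shows "pint p M f = 0 \<longleftrightarrow> (AE x in M. f x = 0)"
  unfolding pint_def by (subst nn_integral_0_iff_AE) (auto simp: ennreal_eq_0_iff)

lemma pint_add:
  fixes f g :: "'a \<Rightarrow> complex"
  assumes [measurable]: "f \<in> borel_measurable M" "g \<in> borel_measurable M" and "0 \<le> p"
  shows "pint p M (\<lambda>x. f x + g x) \<le> ennreal (2 powr p) * (pint p M f + pint p M g)"
proof -
  have "pint p M (\<lambda>x. f x + g x) \<le>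
      (\<integral>\<^sup>+x. ennreal (2 powr p) * (ennreal (norm (f x) powr p) + ennreal (norm (g x) powr p)) \<partial>M)"
    unfolding pint_def
    using norm_add_powr_le[OF \<open>0 \<le> p\<close>]
    by (intro nn_integral_mono) (simp add: ennreal_leI flip: ennreal_plus ennreal_mult)
  also have "\<dots> = ennreal (2 powr p) * (pint p M f + pint p M g)"
    unfolding pint_def by (subst nn_integral_cmult) (auto simp: nn_integral_add)
  finally show ?thesis .
qed

lemma pint_cmult:
  fixes f :: "'a \<Rightarrow> complex"
  assumes [measurable]: "f \<in> borel_measurable M"
  shows "pint p M (\<lambda>x. c * f x) = ennreal (norm c powr p) * pint p M f"
  unfolding pint_def by (subst nn_integral_cmult[symmetric]) (auto simp: norm_mult powr_mult ennreal_mult)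

lemma pint_minus: "pint p M (\<lambda>x. - f x) = pint p M f"
  by (simp add: pint_def)

lemma pint_diff:
  fixes f g :: "'a \<Rightarrow> complex"
  assumes [measurable]: "f \<in> borel_measurable M" "g \<in> borel_measurable M" and "0 \<le> p"
  shows "pint p M (\<lambda>x. f x - g x) \<le> ennreal (2 powr p) * (pint p M f + pint p M g)"
  using pint_add[of f M "\<lambda>x. - g x" p] assms by (simp add: pint_minus)

lemma pint_diff_commute: "pint p M (\<lambda>x. f x - g x) = pint p M (\<lambda>x. g x - f x)"
  by (simp add: pint_def norm_minus_commute)

lemma Lp_add: "f \<in> Lp p M \<Longrightarrow> g \<in> Lp p M \<Longrightarrow> 0 \<le> p \<Longrightarrow> (\<lambda>x. f x + g x) \<in> Lp p M"
  using pint_add[of f M g p]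
  by (auto simp: Lp_def ennreal_mult_less_top intro: le_less_trans)

lemma Lp_cmult: "f \<in> Lp p M \<Longrightarrow> (\<lambda>x. c * f x) \<in> Lp p M"
  by (auto simp: Lp_def pint_cmult ennreal_mult_less_top)

lemma Lp_diff: "f \<in> Lp p M \<Longrightarrow> g \<in> Lp p M \<Longrightarrow> 0 \<le> p \<Longrightarrow> (\<lambda>x. f x - g x) \<in> Lp p M"
  using Lp_add[of f p M "\<lambda>x. (-1) * g x"] Lp_cmult[of g p M "-1"] by simp

lemma Lp_sum:
  assumes "finite I" "\<And>i. i \<in> I \<Longrightarrow> f i \<in> Lp p M" "0 \<le> p"
  shows "(\<lambda>x. \<Sum>i\<in>I. f i x) \<in> Lp p M"
  using assms(1,2)
proof induction
  case empty
  have "pint p M (\<lambda>x. 0::complex) = 0" by (simp add: pint_def)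
  then show ?case by (simp add: Lp_def)
qed (use assms(3) in \<open>auto intro: Lp_add\<close>)

section \<open>Finite measures: \<open>L\<^sup>p\<close> inside \<open>L\<^sup>1\<close>, and
  completeness\<close>

context finite_measure
begin

lemma Lp_bounded:
  assumes [measurable]: "f \<in> borel_measurable M" and "\<And>x. x \<in> space M \<Longrightarrow> norm (f x) \<le> B" "0 \<le> p"
  shows "f \<in> Lp p M"
proof -
  have "pint p M f \<le> (\<integral>\<^sup>+x. ennreal (B powr p) \<partial>M)"
    unfolding pint_def using assms by (intro nn_integral_mono ennreal_leI powr_mono2) auto
  also have "\<dots> < \<infinity>"
    by (simp add: emeasure_eq_measure flip: ennreal_mult)
  finally show ?thesis by (simp add: Lp_def)
qed

text \<open>
  Replaces Hoelder's inequality: pointwise \<open>|t| \<le> e + e powr (1 - p) * |t| powr p\<close>.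
\<close>

lemma nn_integral_norm_le_pint:
  fixes f :: "'a \<Rightarrow> complex"
  assumes [measurable]: "f \<in> borel_measurable M" and p: "1 \<le> p" and e: "0 < e"
  shows "(\<integral>\<^sup>+x. norm (f x) \<partial>M) \<le> ennreal (e * measure M (space M)) + ennreal (e powr (1 - p)) * pint p M f"
proof -
  have *: "t \<le> e + e powr (1 - p) * t powr p" if "0 \<le> t" for t
  proof (cases "t \<le> e")
    case False
    then have "t = t powr (1 - p) * t powr p"
      using e by (simp flip: powr_add)
    also have "\<dots> \<le> e powr (1 - p) * t powr p"
      using False e p by (intro mult_right_mono powr_mono2') auto
    finally show ?thesis using e by linarith
  qed (use e in \<open>auto intro: add_increasing2\<close>)
  have "(\<integral>\<^sup>+x. norm (f x) \<partial>M) \<le> (\<integral>\<^sup>+x. ennreal e + ennreal (e powr (1 - p)) * ennreal (norm (f x) powr p) \<partial>M)"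
    using * e by (intro nn_integral_mono) (simp flip: ennreal_plus ennreal_mult add: ennreal_leI)
  also have "\<dots> = ennreal e * emeasure M (space M) + ennreal (e powr (1 - p)) * pint p M f"
    unfolding pint_def by (subst nn_integral_add) (auto simp: nn_integral_cmult)
  also have "ennreal e * emeasure M (space M) = ennreal (e * measure M (space M))"
    using e by (simp add: emeasure_eq_measure ennreal_mult)
  finally show ?thesis .
qed

lemma Lp_integrable:
  assumes f: "f \<in> Lp p M" and p: "1 \<le> p"
  shows "integrable M f"
proof (rule integrableI_bounded)
  show [measurable]: "f \<in> borel_measurable M" using f by auto
  have "(\<integral>\<^sup>+x. norm (f x) \<partial>M) \<le> ennreal (measure M (space M)) + pint p M f"
    using nn_integral_norm_le_pint[of f p 1] p by simp
  also have "\<dots> < \<infinity>" using f by (simp add: Lp_def)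
  finally show "(\<integral>\<^sup>+x. norm (f x) \<partial>M) < \<infinity>" .
qed

text \<open>The free parameter of the preceding estimate is chosen well: with A the integral of the
  p-th power, \<open>e = A powr (1 / p)\<close> turns both terms into multiples of
  \<open>A powr (1 / p)\<close>. Up to the constant this is Hoelder against the function 1.\<close>

lemma norm_integral_powr_le_pint:
  fixes f :: "'a \<Rightarrow> complex"
  assumes f [measurable]: "f \<in> borel_measurable M" and p: "1 \<le> p"
  shows "ennreal (norm (\<integral>x. f x \<partial>M) powr p) \<le> ennreal ((measure M (space M) + 1) powr p) * pint p M f"
proof (cases "pint p M f < \<infinity>")
  case False
  then have "pint p M f = top" by (metis infinity_ennreal_def top.not_eq_extremum)
  \<comment> \<open>The summand 1 stems from the second term of the estimate below; here it keeps
    the factor nonzero even on a null space, so that its product with \<open>top\<close> is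
    \<open>top\<close>.\<close>
  moreover have "(measure M (space M) + 1) powr p > 0"
    by (smt (verit) measure_nonneg powr_gt_zero)
  ultimately show ?thesis by (simp add: ennreal_mult_top)
next
  case True
  define A where "A = enn2real (pint p M f)"
  have A: "pint p M f = ennreal A" "0 \<le> A"
    using True by (auto simp: A_def less_top)
  let ?m = "measure M (space M)"
  have int: "integrable M f"
    using True p by (intro Lp_integrable[of f p]) (auto simp: Lp_def)
  have le: "norm (\<integral>x. f x \<partial>M) \<le> e * ?m + e powr (1 - p) * A" if "0 < e" for e
  proof -
    have "ennreal (norm (\<integral>x. f x \<partial>M)) \<le> (\<integral>\<^sup>+x. norm (f x) \<partial>M)"
      by (rule integral_norm_bound_ennreal[OF int])
    also have "\<dots> \<le> ennreal (e * ?m) + ennreal (e powr (1 - p)) * pint p M f"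
      by (rule nn_integral_norm_le_pint[OF f p that])
    also have "\<dots> = ennreal (e * ?m + e powr (1 - p) * A)"
      using A that by (simp flip: ennreal_mult ennreal_plus)
    finally show ?thesis
      using that A by (subst (asm) ennreal_le_iff) auto
  qed
  have "norm (\<integral>x. f x \<partial>M) \<le> (?m + 1) * A powr (1 / p)"
  \<comment> \<open>For A = 0 the intended e would be 0, which \<open>le\<close> does not
    admit.\<close>
  proof (cases "A = 0")
    case True
    have "norm (\<integral>x. f x \<partial>M) = 0"
    proof -
      have "AE x in M. f x = 0"
        using pint_eq_0_iff[OF f, of p] A True by simp
      then show ?thesis by (simp add: integral_eq_zero_AE)
    qed
    then show ?thesis using True by simp
  next
    case False
    then have "0 < A" using A by simp
    have "(A powr (1 / p)) powr (1 - p) * A = A powr ((1 - p) / p) * A powr 1"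
      using \<open>0 < A\<close> by (simp add: powr_powr)
    also have "\<dots> = A powr (1 / p)"
      unfolding powr_add[symmetric] using p by (simp add: diff_divide_distrib)
    finally show ?thesis
      using le[of "A powr (1 / p)"] \<open>0 < A\<close> by (simp add: algebra_simps)
  qed
  then have "norm (\<integral>x. f x \<partial>M) powr p \<le> ((?m + 1) * A powr (1 / p)) powr p"
    using p by (intro powr_mono2) auto
  also have "\<dots> = (?m + 1) powr p * A"
    using A p by (simp add: powr_mult powr_powr)
  finally show ?thesis
    using A by (simp flip: ennreal_mult add: ennreal_leI)
qed

text \<open>Riesz--Fischer: an \<open>L\<^sup>1\<close>-Cauchy subsequence converges almost everywhere; then Fatou.\<close>

lemma Lp_complete:
  fixes u :: "nat \<Rightarrow> 'a \<Rightarrow> complex"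
  assumes u: "\<And>n. u n \<in> Lp p M" and p: "1 \<le> p"
    and Cauchy: "\<And>e. 0 < e \<Longrightarrow> \<exists>n0. \<forall>m\<ge>n0. \<forall>n\<ge>n0. pint p M (\<lambda>x. u m x - u n x) \<le> ennreal e"
  shows "\<exists>v\<in>Lp p M. (\<lambda>n. pint p M (\<lambda>x. u n x - v x)) \<longlonglongrightarrow> 0"
proof -
  have [measurable]: "\<And>n. u n \<in> borel_measurable M" using u by auto
  have int: "integrable M (u n)" for n using Lp_integrable[OF u p] .
  have L1: "\<exists>n0. \<forall>m\<ge>n0. \<forall>n\<ge>n0. (LINT x|M. norm (u m x - u n x)) < e" if "0 < e" for e
  proof -
    let ?m = "measure M (space M)"
    \<comment> \<open>The pointwise bound is used with d in the role of e: d keeps the constant term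
      below e / 2, and d' is calibrated so that the other term is exactly e / 2. Adding 1 to the
      total mass avoids division by 0.\<close>
    define d where "d = e / (2 * (?m + 1))"
    have d: "0 < d" "d * ?m < e / 2"
      using that by (auto simp: d_def field_simps add_pos_nonneg add_nonneg_pos)
    define d' where "d' = e / 2 * d powr (p - 1)"
    have "0 < d'" using that d by (simp add: d'_def)
    then obtain n0 where n0: "\<And>m n. m \<ge> n0 \<Longrightarrow> n \<ge> n0 \<Longrightarrow> pint p M (\<lambda>x. u m x - u n x) \<le> ennreal d'"
      using Cauchy by metis
    show ?thesis
    proof (intro exI allI impI)
      fix m n assume mn: "n0 \<le> m" "n0 \<le> n"
      have "ennreal (LINT x|M. norm (u m x - u n x)) = (\<integral>\<^sup>+x. norm (u m x - u n x) \<partial>M)"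
        using int by (intro nn_integral_eq_integral[symmetric]) auto
      also have "\<dots> \<le> ennreal (d * ?m) + ennreal (d powr (1 - p)) * pint p M (\<lambda>x. u m x - u n x)"
        by (rule nn_integral_norm_le_pint) (use p d in auto)
      also have "\<dots> \<le> ennreal (d * ?m) + ennreal (d powr (1 - p)) * ennreal d'"
        by (intro add_left_mono mult_left_mono n0 mn) auto
      also have "\<dots> = ennreal (d * ?m + d powr (1 - p) * d')"
        using d \<open>0 < d'\<close> by (simp flip: ennreal_mult ennreal_plus)
      also have "d powr (1 - p) * d' = e / 2"
        using d by (simp add: d'_def flip: powr_add)
      also have "ennreal (d * ?m + e / 2) < ennreal e"
        using d that by (intro ennreal_lessI) auto
      finally show "(LINT x|M. norm (u m x - u n x)) < e"
        by (subst (asm) ennreal_less_iff) auto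
    qed
  qed
  obtain r where r: "strict_mono r" "AE x in M. Cauchy (\<lambda>i. u (r i) x)"
    using cauchy_L1_AE_cauchy_subseq[OF int L1] by metis
  define v where "v x = lim (\<lambda>i. u (r i) x)" for x
  have [measurable]: "v \<in> borel_measurable M" unfolding v_def by measurable
  have lim: "AE x in M. (\<lambda>i. u (r i) x) \<longlonglongrightarrow> v x"
    using r(2) by eventually_elim (simp add: v_def Cauchy_convergent_iff convergent_LIMSEQ_iff)
  \<comment> \<open>Almost everywhere the integrand is the limit of those with
    \<open>u (r i)\<close> in place of v. Since \<open>r i\<close> eventually exceeds n0, Fatou
    carries the Cauchy bound over to v.\<close>
  have Fatou: "pint p M (\<lambda>x. u n x - v x) \<le> ennreal e"
    if "0 < e" "n0 \<le> n" "\<And>m n. m \<ge> n0 \<Longrightarrow> n \<ge> n0 \<Longrightarrow> pint p M (\<lambda>x. u m x - u n x) \<le> ennreal e"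
    for e n n0
  proof -
    have "pint p M (\<lambda>x. u n x - v x) = (\<integral>\<^sup>+x. liminf (\<lambda>i. ennreal (norm (u n x - u (r i) x) powr p)) \<partial>M)"
      unfolding pint_def
    proof (rule nn_integral_cong_AE, use lim in eventually_elim)
      case (elim x)
      have "(\<lambda>i. ennreal (norm (u n x - u (r i) x) powr p)) \<longlonglongrightarrow> ennreal (norm (u n x - v x) powr p)"
        using p elim by (intro tendsto_ennrealI tendsto_powr') (auto intro!: tendsto_intros)
      from lim_imp_Liminf[OF _ this] show ?case by simp
    qed
    also have "\<dots> \<le> liminf (\<lambda>i. pint p M (\<lambda>x. u n x - u (r i) x))"
      unfolding pint_def by (rule nn_integral_liminf) simp
    also have "\<dots> \<le> ennreal e"
    proof (rule Liminf_le)
      show "\<forall>\<^sub>F i in sequentially. pint p M (\<lambda>x. u n x - u (r i) x) \<le> ennreal e"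
        using eventually_ge_at_top[of n0]
        by eventually_elim (use that strict_mono_imp_increasing[OF r(1)] le_trans in blast)
    qed simp
    finally show ?thesis .
  qed
  have v: "v \<in> Lp p M"
  proof -
    obtain n0 where n0: "\<And>m n. m \<ge> n0 \<Longrightarrow> n \<ge> n0 \<Longrightarrow> pint p M (\<lambda>x. u m x - u n x) \<le> ennreal 1"
      using Cauchy[of 1] by auto
    have "pint p M (\<lambda>x. u n0 x - v x) \<le> ennreal 1"
      by (rule Fatou[OF _ _ n0]) auto
    then have "(\<lambda>x. u n0 x - v x) \<in> Lp p M"
      by (auto simp: Lp_def intro: le_less_trans)
    from Lp_diff[OF u[of n0] this] p show ?thesis by simp
  qed
  moreover have "(\<lambda>n. pint p M (\<lambda>x. u n x - v x)) \<longlonglongrightarrow> 0"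
  proof (rule ennreal_tendsto_0I)
    fix e :: real assume e: "0 < e"
    obtain n0 where n0: "\<And>m n. m \<ge> n0 \<Longrightarrow> n \<ge> n0 \<Longrightarrow> pint p M (\<lambda>x. u m x - u n x) \<le> ennreal e"
      using Cauchy e by metis
    show "\<forall>\<^sub>F n in sequentially. pint p M (\<lambda>x. u n x - v x) \<le> ennreal e"
      by (rule eventually_sequentiallyI[of n0]) (use Fatou[OF e _ n0] in auto)
  qed
  ultimately show ?thesis by blast
qed

end

section \<open>Operators acting with parameters\<close>

lemma pint_triangle:
  fixes f g h :: "'a \<Rightarrow> complex"
  assumes [measurable]: "f \<in> borel_measurable M" "g \<in> borel_measurable M" "h \<in> borel_measurable M"
    and "0 \<le> p"
  shows "pint p M (\<lambda>x. f x - h x) \<le> ennreal (2 powr p) * (pint p M (\<lambda>x. f x - g x) + pint p M (\<lambda>x. g x - h x))"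
  using pint_add[of "\<lambda>x. f x - g x" M "\<lambda>x. g x - h x" p] assms by simp

lemma ennreal_tendsto_0_lincomb:
  fixes x y :: "nat \<Rightarrow> ennreal"
  assumes "x \<longlonglongrightarrow> 0" "y \<longlonglongrightarrow> 0" "a < top" "b < top" "c < top"
  shows "(\<lambda>n. c * (a * x n + b * y n)) \<longlonglongrightarrow> 0"
proof -
  have "(\<lambda>n. c * (a * x n + b * y n)) \<longlonglongrightarrow> c * (a * 0 + b * 0)"
    using assms by (intro ennreal_tendsto_cmult tendsto_add) auto
  then show ?thesis by simp
qed

text \<open>\<open>M\<close> measures the variable on which \<open>S\<close> acts, \<open>N\<close>
  the parameter. Compatibility with a.e. equality follows from linearity and the bound, see
  \<open>S_cong\<close>. A negative C acts as 0, since \<open>ennreal\<close> truncates.\<close>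

locale bounded_Lp_operator_pair = M: finite_measure M + N: finite_measure N
  for M :: "'a measure" and N :: "'b measure" +
  fixes p :: real and S :: "('a \<Rightarrow> complex) \<Rightarrow> 'a \<Rightarrow> complex" and C :: real
  assumes p: "1 < p"
    and S_Lp: "f \<in> Lp p M \<Longrightarrow> S f \<in> Lp p M"
    and S_add: "f \<in> Lp p M \<Longrightarrow> g \<in> Lp p M \<Longrightarrow> AE z in M. S (\<lambda>z. f z + g z) z = S f z + S g z"
    and S_cmult: "f \<in> Lp p M \<Longrightarrow> AE z in M. S (\<lambda>z. c * f z) z = c * S f z"
    and S_bound: "f \<in> Lp p M \<Longrightarrow> pint p M (S f) \<le> ennreal C * pint p M f"
begin

sublocale MN: pair_sigma_finite M N ..

sublocale MN: finite_measure "M \<Otimes>\<^sub>M N"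
  by (intro finite_measure_pair_measure M.finite_measure_axioms N.finite_measure_axioms)

lemma p_ge: "0 \<le> p" "1 \<le> p" using p by auto

lemma S_measurable: "f \<in> Lp p M \<Longrightarrow> S f \<in> borel_measurable M"
  using S_Lp by auto

lemma S_diff_bound:
  assumes f: "f \<in> Lp p M" and g: "g \<in> Lp p M"
  shows "pint p M (\<lambda>z. S f z - S g z) \<le> ennreal C * pint p M (\<lambda>z. f z - g z)"
proof -
  have "AE z in M. S (\<lambda>z. f z + (-1) * g z) z = S f z + S (\<lambda>z. (-1) * g z) z"
    by (intro S_add f Lp_cmult g)
  moreover have "AE z in M. S (\<lambda>z. (-1) * g z) z = (-1) * S g z"
    by (intro S_cmult g)
  ultimately have "AE z in M. S f z - S g z = S (\<lambda>z. f z - g z) z"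
    by eventually_elim simp
  then have "pint p M (\<lambda>z. S f z - S g z) = pint p M (S (\<lambda>z. f z - g z))"
    by (rule pint_cong_AE)
  also have "\<dots> \<le> ennreal C * pint p M (\<lambda>z. f z - g z)"
    by (intro S_bound Lp_diff f g p_ge)
  finally show ?thesis .
qed

lemma S_cong:
  assumes f: "f \<in> Lp p M" and g: "g \<in> Lp p M" and "AE z in M. f z = g z"
  shows "AE z in M. S f z = S g z"
proof -
  have [measurable]: "S f \<in> borel_measurable M" "S g \<in> borel_measurable M"
    using f g by (auto intro: S_measurable)
  have "pint p M (\<lambda>z. f z - g z) = pint p M (\<lambda>z. 0::complex)"
    by (rule pint_cong_AE) (use assms(3) in auto)
  then have "pint p M (\<lambda>z. S f z - S g z) = 0"
    using S_diff_bound[OF f g] by (simp add: pint_def)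
  then show ?thesis by (subst (asm) pint_eq_0_iff) auto
qed

lemma pint_pair_snd:
  fixes f :: "'a \<times> 'b \<Rightarrow> complex"
  assumes [measurable]: "f \<in> borel_measurable (M \<Otimes>\<^sub>M N)"
  shows "pint p (M \<Otimes>\<^sub>M N) f = (\<integral>\<^sup>+w. pint p M (\<lambda>z. f (z, w)) \<partial>N)"
  unfolding pint_def by (subst MN.nn_integral_snd[symmetric]) auto

lemma pint_pair_fst:
  fixes f :: "'a \<times> 'b \<Rightarrow> complex"
  assumes [measurable]: "f \<in> borel_measurable (M \<Otimes>\<^sub>M N)"
  shows "pint p (M \<Otimes>\<^sub>M N) f = (\<integral>\<^sup>+z. pint p N (\<lambda>w. f (z, w)) \<partial>M)"
  unfolding pint_def by (subst N.nn_integral_fst[symmetric]) auto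

lemma pint_slice_measurable:
  fixes f :: "'a \<times> 'b \<Rightarrow> complex"
  assumes [measurable]: "f \<in> borel_measurable (M \<Otimes>\<^sub>M N)"
  shows "(\<lambda>w. pint p M (\<lambda>z. f (z, w))) \<in> borel_measurable N"
  unfolding pint_def by measurable

lemma Lp_slice:
  assumes f: "f \<in> Lp p (M \<Otimes>\<^sub>M N)"
  shows "AE w in N. (\<lambda>z. f (z, w)) \<in> Lp p M"
proof -
  have [measurable]: "f \<in> borel_measurable (M \<Otimes>\<^sub>M N)" using f by auto
  note [measurable] = pint_slice_measurable
  have "AE w in N. pint p M (\<lambda>z. f (z, w)) \<noteq> \<infinity>"
    using f by (intro nn_integral_PInf_AE) (auto simp: Lp_def pint_pair_snd)
  then show ?thesis
    using AE_space by eventually_elim (auto simp: Lp_def less_top)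
qed

text \<open>The scalar counterpart of \<open>acts_fibrewise\<close>, for abstract measures.\<close>

definition acts :: "('a \<times> 'b \<Rightarrow> complex) \<Rightarrow> ('a \<times> 'b \<Rightarrow> complex) \<Rightarrow> bool" where
  "acts g u \<longleftrightarrow> u \<in> Lp p (M \<Otimes>\<^sub>M N) \<and>
     (AE w in N. (\<lambda>z. g (z, w)) \<in> Lp p M \<and> (AE z in M. u (z, w) = S (\<lambda>z. g (z, w)) z))"

lemma acts_measurable: "acts g u \<Longrightarrow> u \<in> borel_measurable (M \<Otimes>\<^sub>M N)"
  by (auto simp: acts_def)

text \<open>The bound on slices is integrated over the parameter by Tonelli, with the same constant.
  It yields uniqueness of the result as well as the transfer of Cauchy sequences from g to
  \<open>S g\<close>.\<close>

lemma acts_diff_bound: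
  assumes gu: "acts g u" and hv: "acts h v" and g: "g \<in> Lp p (M \<Otimes>\<^sub>M N)" and h: "h \<in> Lp p (M \<Otimes>\<^sub>M N)"
  shows "pint p (M \<Otimes>\<^sub>M N) (\<lambda>x. u x - v x) \<le> ennreal C * pint p (M \<Otimes>\<^sub>M N) (\<lambda>x. g x - h x)"
proof -
  note [measurable] = acts_measurable[OF gu] acts_measurable[OF hv] Lp_measurable[OF g] Lp_measurable[OF h]
  have "AE w in N. pint p M (\<lambda>z. u (z, w) - v (z, w)) \<le> ennreal C * pint p M (\<lambda>z. g (z, w) - h (z, w))"
    using gu[unfolded acts_def, THEN conjunct2] hv[unfolded acts_def, THEN conjunct2]
  proof eventually_elim
    case (elim w)
    have "pint p M (\<lambda>z. u (z, w) - v (z, w)) = pint p M (\<lambda>z. S (\<lambda>z. g (z, w)) z - S (\<lambda>z. h (z, w)) z)"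
      using elim by (intro pint_cong_AE) auto
    also have "\<dots> \<le> ennreal C * pint p M (\<lambda>z. g (z, w) - h (z, w))"
      using elim by (intro S_diff_bound) auto
    finally show ?case .
  qed
  then have "pint p (M \<Otimes>\<^sub>M N) (\<lambda>x. u x - v x) \<le> (\<integral>\<^sup>+w. ennreal C * pint p M (\<lambda>z. g (z, w) - h (z, w)) \<partial>N)"
    by (subst pint_pair_snd) (auto intro: nn_integral_mono_AE)
  also have "\<dots> = ennreal C * pint p (M \<Otimes>\<^sub>M N) (\<lambda>x. g x - h x)"
    by (subst nn_integral_cmult) (auto simp: pint_pair_snd intro: pint_slice_measurable)
  finally show ?thesis .
qed

lemma acts_unique:
  assumes gu: "acts g u" and gv: "acts g v" and g: "g \<in> Lp p (M \<Otimes>\<^sub>M N)"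
  shows "AE x in M \<Otimes>\<^sub>M N. u x = v x"
proof -
  note [measurable] = acts_measurable[OF gu] acts_measurable[OF gv]
  have "pint p (M \<Otimes>\<^sub>M N) (\<lambda>x. u x - v x) = 0"
    using acts_diff_bound[OF gu gv g g] by (simp add: pint_def)
  then show ?thesis by (subst (asm) pint_eq_0_iff) auto
qed

section \<open>Integration against a bounded weight in the parameter\<close>

definition avg :: "('b \<Rightarrow> complex) \<Rightarrow> ('a \<times> 'b \<Rightarrow> complex) \<Rightarrow> 'a \<Rightarrow> complex" where
  "avg \<eta> f z = (\<integral>w. f (z, w) * \<eta> w \<partial>N)"

definition bounded_weight :: "('b \<Rightarrow> complex) \<Rightarrow> bool" where
  "bounded_weight \<eta> \<longleftrightarrow> \<eta> \<in> borel_measurable N \<and> (\<exists>B. \<forall>w. norm (\<eta> w) \<le> B)"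

lemma bounded_weight_measurable: "bounded_weight \<eta> \<Longrightarrow> \<eta> \<in> borel_measurable N"
  by (simp add: bounded_weight_def)

lemma avg_measurable:
  assumes [measurable]: "f \<in> borel_measurable (M \<Otimes>\<^sub>M N)" and \<eta>: "bounded_weight \<eta>"
  shows "avg \<eta> f \<in> borel_measurable M"
proof -
  note [measurable] = bounded_weight_measurable[OF \<eta>]
  show ?thesis unfolding avg_def[abs_def] by measurable
qed

text \<open>K depends on the weight alone, which makes averaging continuous in f. Its factors are
  the constant of \<open>norm_integral_powr_le_pint\<close> for \<open>N\<close> and the p-th power
  of the bound of the weight.\<close>

lemma avg_bound:
  assumes \<eta>: "bounded_weight \<eta>"
  obtains K :: real where "0 \<le> K"
    "\<And>f. f \<in> borel_measurable (M \<Otimes>\<^sub>M N) \<Longrightarrow> pint p M (avg \<eta> f) \<le> ennreal K * pint p (M \<Otimes>\<^sub>M N) f"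
proof -
  note [measurable] = bounded_weight_measurable[OF \<eta>]
  obtain B where B: "\<And>w. norm (\<eta> w) \<le> B" using \<eta> by (auto simp: bounded_weight_def)
  then have "0 \<le> B" using norm_ge_zero order_trans by blast
  define k where "k = (measure N (space N) + 1) powr p"
  have "pint p M (avg \<eta> f) \<le> ennreal (k * B powr p) * pint p (M \<Otimes>\<^sub>M N) f"
    if [measurable]: "f \<in> borel_measurable (M \<Otimes>\<^sub>M N)" for f
  proof -
    have "pint p M (avg \<eta> f) \<le> (\<integral>\<^sup>+z. ennreal (k * B powr p) * pint p N (\<lambda>w. f (z, w)) \<partial>M)"
      unfolding pint_def[of p M]
    proof (intro nn_integral_mono)
      fix z assume [measurable]: "z \<in> space M"
      have "ennreal (norm (avg \<eta> f z) powr p) \<le> ennreal k * pint p N (\<lambda>w. f (z, w) * \<eta> w)"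
        unfolding avg_def k_def by (intro N.norm_integral_powr_le_pint p_ge) measurable
      also have "pint p N (\<lambda>w. f (z, w) * \<eta> w) \<le> pint p N (\<lambda>w. complex_of_real B * f (z, w))"
        using B \<open>0 \<le> B\<close>
        by (intro pint_mono_AE p_ge AE_I2) (simp add: norm_mult mult.commute mult_right_mono)
      also have "\<dots> = ennreal (B powr p) * pint p N (\<lambda>w. f (z, w))"
        using \<open>0 \<le> B\<close> by (subst pint_cmult) auto
      finally show "ennreal (norm (avg \<eta> f z) powr p) \<le> ennreal (k * B powr p) * pint p N (\<lambda>w. f (z, w))"
        by (auto simp: k_def ennreal_mult mult.assoc mult_left_mono)
    qed
    also have "\<dots> = ennreal (k * B powr p) * pint p (M \<Otimes>\<^sub>M N) f"
      by (subst nn_integral_cmult) (auto simp: pint_pair_fst, simp add: pint_def)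
    finally show ?thesis .
  qed
  then show ?thesis by (intro that[of "k * B powr p"]) (auto simp: k_def)
qed

lemma avg_Lp:
  assumes f: "f \<in> Lp p (M \<Otimes>\<^sub>M N)" and \<eta>: "bounded_weight \<eta>"
  shows "avg \<eta> f \<in> Lp p M"
proof -
  obtain K where "pint p M (avg \<eta> f) \<le> ennreal K * pint p (M \<Otimes>\<^sub>M N) f"
    using avg_bound[OF \<eta>] f by (metis Lp_measurable)
  also have "\<dots> < \<infinity>"
    using f by (simp add: Lp_def ennreal_mult_less_top)
  finally show ?thesis
    using f by (auto simp: Lp_def intro!: avg_measurable \<eta>)
qed

text \<open>Averaging is additive only where the slices are integrable, because the integral takes
  the default value 0 elsewhere. On a finite measure \<open>L\<^sup>p\<close> lies in
  \<open>L\<^sup>1\<close>, so Fubini makes almost every slice integrable.\<close>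

lemma AE_integrable_weight:
  assumes f: "f \<in> Lp p (M \<Otimes>\<^sub>M N)" and \<eta>: "bounded_weight \<eta>"
  shows "AE z in M. integrable N (\<lambda>w. f (z, w) * \<eta> w)"
proof -
  note [measurable] = bounded_weight_measurable[OF \<eta>]
  obtain B where B: "\<And>w. norm (\<eta> w) \<le> B" using \<eta> by (auto simp: bounded_weight_def)
  have "AE z in M. integrable N (\<lambda>w. f (z, w))"
    by (intro MN.AE_integrable_fst' MN.Lp_integrable[OF f p_ge(2)])
  then show ?thesis
  proof eventually_elim
    case (elim z)
    show ?case
    proof (rule Bochner_Integration.integrable_bound[of N "\<lambda>w. of_real B * f (z, w)"])
      show "AE w in N. norm (f (z, w) * \<eta> w) \<le> norm (of_real B * f (z, w))"
        using B by (intro AE_I2) (metis abs_ge_self dual_order.trans mult.commute mult_right_mono norm_ge_zero norm_mult norm_of_real)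
    qed (use elim borel_measurable_integrable[OF elim] in auto)
  qed
qed

lemma avg_add:
  assumes "f \<in> Lp p (M \<Otimes>\<^sub>M N)" "g \<in> Lp p (M \<Otimes>\<^sub>M N)" "bounded_weight \<eta>"
  shows "AE z in M. avg \<eta> (\<lambda>x. f x + g x) z = avg \<eta> f z + avg \<eta> g z"
  using AE_integrable_weight[OF assms(1,3)] AE_integrable_weight[OF assms(2,3)]
  by eventually_elim (simp add: avg_def distrib_right)

lemma avg_cmult: "avg \<eta> (\<lambda>x. c * f x) z = c * avg \<eta> f z"
  by (simp add: avg_def mult.assoc)

lemma avg_diff:
  assumes "f \<in> Lp p (M \<Otimes>\<^sub>M N)" "g \<in> Lp p (M \<Otimes>\<^sub>M N)" "bounded_weight \<eta>"
  shows "AE z in M. avg \<eta> (\<lambda>x. f x - g x) z = avg \<eta> f z - avg \<eta> g z"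
  using AE_integrable_weight[OF assms(1,3)] AE_integrable_weight[OF assms(2,3)]
  by eventually_elim (simp add: avg_def left_diff_distrib)

lemma avg_diff_bound:
  assumes \<eta>: "bounded_weight \<eta>"
  obtains K :: real where "0 \<le> K"
    "\<And>f g. f \<in> Lp p (M \<Otimes>\<^sub>M N) \<Longrightarrow> g \<in> Lp p (M \<Otimes>\<^sub>M N) \<Longrightarrow>
       pint p M (\<lambda>z. avg \<eta> f z - avg \<eta> g z) \<le> ennreal K * pint p (M \<Otimes>\<^sub>M N) (\<lambda>x. f x - g x)"
proof -
  obtain K where K: "0 \<le> K"
    "\<And>f. f \<in> borel_measurable (M \<Otimes>\<^sub>M N) \<Longrightarrow> pint p M (avg \<eta> f) \<le> ennreal K * pint p (M \<Otimes>\<^sub>M N) f"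
    using avg_bound[OF \<eta>] by metis
  show thesis
  proof (rule that[OF K(1)])
    fix f g assume *: "f \<in> Lp p (M \<Otimes>\<^sub>M N)" "g \<in> Lp p (M \<Otimes>\<^sub>M N)"
    have "pint p M (\<lambda>z. avg \<eta> f z - avg \<eta> g z) = pint p M (avg \<eta> (\<lambda>x. f x - g x))"
      using avg_diff[OF * \<eta>] by (intro pint_cong_AE) (auto elim!: eventually_mono)
    also have "\<dots> \<le> ennreal K * pint p (M \<Otimes>\<^sub>M N) (\<lambda>x. f x - g x)"
      using * by (intro K borel_measurable_diff Lp_measurable)
    finally show "pint p M (\<lambda>z. avg \<eta> f z - avg \<eta> g z) \<le> ennreal K * pint p (M \<Otimes>\<^sub>M N) (\<lambda>x. f x - g x)" .
  qed
qed

text \<open>The property to be propagated by approximation. Existence of u is part of it, and one u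
  has to serve all weights.\<close>

definition commutes_with_avg :: "('a \<times> 'b \<Rightarrow> complex) \<Rightarrow> bool" where
  "commutes_with_avg g \<longleftrightarrow> g \<in> Lp p (M \<Otimes>\<^sub>M N) \<and>
     (\<exists>u. acts g u \<and> (\<forall>\<eta>. bounded_weight \<eta> \<longrightarrow> (AE z in M. S (avg \<eta> g) z = avg \<eta> u z)))"

lemma commutes_with_avg_cong:
  assumes "commutes_with_avg g" and eq: "\<And>x. x \<in> space (M \<Otimes>\<^sub>M N) \<Longrightarrow> g x = h x"
  shows "commutes_with_avg h"
proof -
  obtain u where u: "acts g u" "\<And>\<eta>. bounded_weight \<eta> \<Longrightarrow> AE z in M. S (avg \<eta> g) z = avg \<eta> u z"
    and g: "g \<in> Lp p (M \<Otimes>\<^sub>M N)"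
    using assms(1) by (auto simp: commutes_with_avg_def)
  have h: "h \<in> Lp p (M \<Otimes>\<^sub>M N)"
    using g measurable_cong[of "M \<Otimes>\<^sub>M N" g h borel] pint_cong_AE[where M="M \<Otimes>\<^sub>M N" and f=g and g=h and p=p] eq
    by (auto simp: Lp_def)
  have "acts h u"
    unfolding acts_def
  proof
    show "AE w in N. (\<lambda>z. h (z, w)) \<in> Lp p M \<and> (AE z in M. u (z, w) = S (\<lambda>z. h (z, w)) z)"
      using u(1)[unfolded acts_def, THEN conjunct2] Lp_slice[OF h] AE_space
    proof eventually_elim
      case (elim w)
      then have "AE z in M. S (\<lambda>z. g (z, w)) z = S (\<lambda>z. h (z, w)) z"
        using eq by (intro S_cong AE_I2) (auto simp: space_pair_measure)
      then show ?case using elim by auto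
    qed
  qed (use u in \<open>simp add: acts_def\<close>)
  moreover have "AE z in M. S (avg \<eta> h) z = avg \<eta> u z" if \<eta>: "bounded_weight \<eta>" for \<eta>
  proof -
    have "AE z in M. S (avg \<eta> h) z = S (avg \<eta> g) z"
      using eq
      by (intro S_cong avg_Lp h g \<eta> AE_I2)
         (auto simp: avg_def space_pair_measure intro!: Bochner_Integration.integral_cong)
    then show ?thesis using u(2)[OF \<eta>] by eventually_elim simp
  qed
  ultimately show ?thesis using h by (auto simp: commutes_with_avg_def)
qed

lemma commutes_with_avg_add:
  assumes "commutes_with_avg f" "commutes_with_avg g"
  shows "commutes_with_avg (\<lambda>x. f x + g x)"
proof -
  obtain u where f: "f \<in> Lp p (M \<Otimes>\<^sub>M N)" and u: "acts f u" "\<And>\<eta>. bounded_weight \<eta> \<Longrightarrow> AE z in M. S (avg \<eta> f) z = avg \<eta> u z"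
    using assms(1) by (auto simp: commutes_with_avg_def)
  obtain v where g: "g \<in> Lp p (M \<Otimes>\<^sub>M N)" and v: "acts g v" "\<And>\<eta>. bounded_weight \<eta> \<Longrightarrow> AE z in M. S (avg \<eta> g) z = avg \<eta> v z"
    using assms(2) by (auto simp: commutes_with_avg_def)
  have uv: "u \<in> Lp p (M \<Otimes>\<^sub>M N)" "v \<in> Lp p (M \<Otimes>\<^sub>M N)" using u(1) v(1) by (auto simp: acts_def)
  have "acts (\<lambda>x. f x + g x) (\<lambda>x. u x + v x)"
    unfolding acts_def
  proof
    show "AE w in N. (\<lambda>z. f (z, w) + g (z, w)) \<in> Lp p M \<and>
        (AE z in M. u (z, w) + v (z, w) = S (\<lambda>z. f (z, w) + g (z, w)) z)"
      using u(1)[unfolded acts_def, THEN conjunct2] v(1)[unfolded acts_def, THEN conjunct2]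
    proof eventually_elim
      case (elim w)
      then have "AE z in M. S (\<lambda>z. f (z, w) + g (z, w)) z = S (\<lambda>z. f (z, w)) z + S (\<lambda>z. g (z, w)) z"
        by (intro S_add) auto
      then show ?case using elim p_ge by (auto intro: Lp_add)
    qed
  qed (intro Lp_add uv p_ge)
  moreover have "AE z in M. S (avg \<eta> (\<lambda>x. f x + g x)) z = avg \<eta> (\<lambda>x. u x + v x) z" if \<eta>: "bounded_weight \<eta>" for \<eta>
  proof -
    have "AE z in M. S (avg \<eta> (\<lambda>x. f x + g x)) z = S (\<lambda>z. avg \<eta> f z + avg \<eta> g z) z"
      by (intro S_cong avg_add f g \<eta> avg_Lp Lp_add p_ge)
    moreover have "AE z in M. S (\<lambda>z. avg \<eta> f z + avg \<eta> g z) z = S (avg \<eta> f) z + S (avg \<eta> g) z"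
      by (intro S_add avg_Lp f g \<eta>)
    ultimately show ?thesis
      using avg_add[OF uv \<eta>] u(2)[OF \<eta>] v(2)[OF \<eta>] by eventually_elim simp
  qed
  ultimately show ?thesis using Lp_add[OF f g p_ge(1)] by (auto simp: commutes_with_avg_def)
qed

lemma commutes_with_avg_cmult:
  assumes "commutes_with_avg f"
  shows "commutes_with_avg (\<lambda>x. c * f x)"
proof -
  obtain u where f: "f \<in> Lp p (M \<Otimes>\<^sub>M N)" and u: "acts f u" "\<And>\<eta>. bounded_weight \<eta> \<Longrightarrow> AE z in M. S (avg \<eta> f) z = avg \<eta> u z"
    using assms(1) by (auto simp: commutes_with_avg_def)
  have "acts (\<lambda>x. c * f x) (\<lambda>x. c * u x)"
    unfolding acts_def
  proof
    show "AE w in N. (\<lambda>z. c * f (z, w)) \<in> Lp p M \<and> (AE z in M. c * u (z, w) = S (\<lambda>z. c * f (z, w)) z)"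
      using u(1)[unfolded acts_def, THEN conjunct2]
    proof eventually_elim
      case (elim w)
      then have "AE z in M. S (\<lambda>z. c * f (z, w)) z = c * S (\<lambda>z. f (z, w)) z"
        by (intro S_cmult) auto
      then show ?case using elim by (auto intro: Lp_cmult)
    qed
  qed (use u(1) in \<open>auto simp: acts_def intro: Lp_cmult\<close>)
  moreover have "AE z in M. S (avg \<eta> (\<lambda>x. c * f x)) z = avg \<eta> (\<lambda>x. c * u x) z" if \<eta>: "bounded_weight \<eta>" for \<eta>
    using S_cmult[OF avg_Lp[OF f \<eta>], of c] u(2)[OF \<eta>]
    by eventually_elim (simp add: avg_cmult[abs_def])
  ultimately show ?thesis using Lp_cmult[OF f] by (auto simp: commutes_with_avg_def)
qed

text \<open>By \<open>acts_diff_bound\<close> the images of \<open>g n\<close> form a Cauchy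
  sequence, and completeness gives a candidate v. It remains to identify almost every slice of v
  with \<open>S\<close> of the slice of h, and the averages of v with \<open>S\<close> of the
  averages of h; both follow from continuity of the operators involved.\<close>

lemma commutes_with_avg_limit:
  assumes commutes_with_avg: "\<And>n. commutes_with_avg (g n)" and h: "h \<in> Lp p (M \<Otimes>\<^sub>M N)"
    and lim: "(\<lambda>n. pint p (M \<Otimes>\<^sub>M N) (\<lambda>x. g n x - h x)) \<longlonglongrightarrow> 0"
  shows "commutes_with_avg h"
proof -
  have g: "g n \<in> Lp p (M \<Otimes>\<^sub>M N)" for n using commutes_with_avg by (auto simp: commutes_with_avg_def)
  have "\<forall>n. \<exists>u. acts (g n) u \<and> (\<forall>\<eta>. bounded_weight \<eta> \<longrightarrow> (AE z in M. S (avg \<eta> (g n)) z = avg \<eta> u z))"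
    using commutes_with_avg unfolding commutes_with_avg_def by blast
  then obtain u where u: "\<And>n. acts (g n) (u n)"
    "\<And>n \<eta>. bounded_weight \<eta> \<Longrightarrow> AE z in M. S (avg \<eta> (g n)) z = avg \<eta> (u n) z"
    by metis
  have uLp: "u n \<in> Lp p (M \<Otimes>\<^sub>M N)" for n using u(1)[of n] by (simp add: acts_def)
  note [measurable] = Lp_measurable[OF g] Lp_measurable[OF h] Lp_measurable[OF uLp]
  have "\<exists>n0. \<forall>m\<ge>n0. \<forall>n\<ge>n0. pint p (M \<Otimes>\<^sub>M N) (\<lambda>x. u m x - u n x) \<le> ennreal e" if "0 < e" for e
  proof -
    \<comment> \<open>Two errors d, the factor \<open>2 powr p\<close> and the operator bound
      combine to exactly e; \<open>\<bar>C\<bar> + 1\<close> dominates C and is never 0.\<close>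
    define d where "d = e / (2 * 2 powr p * (\<bar>C\<bar> + 1))"
    have d: "0 < d" using that by (auto simp: d_def intro!: divide_pos_pos mult_pos_pos)
    have "\<forall>\<^sub>F n in sequentially. pint p (M \<Otimes>\<^sub>M N) (\<lambda>x. g n x - h x) < ennreal d"
      using lim d by (auto simp: order_tendsto_iff)
    then obtain n0 where n0: "\<And>n. n \<ge> n0 \<Longrightarrow> pint p (M \<Otimes>\<^sub>M N) (\<lambda>x. g n x - h x) < ennreal d"
      by (auto simp: eventually_sequentially)
    show ?thesis
    proof (intro exI allI impI)
      fix m n assume mn: "n0 \<le> m" "n0 \<le> n"
      have "pint p (M \<Otimes>\<^sub>M N) (\<lambda>x. u m x - u n x) \<le> ennreal C * pint p (M \<Otimes>\<^sub>M N) (\<lambda>x. g m x - g n x)"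
        by (intro acts_diff_bound u g)
      also have "\<dots> \<le> ennreal (\<bar>C\<bar> + 1) * (ennreal (2 powr p) *
          (pint p (M \<Otimes>\<^sub>M N) (\<lambda>x. g m x - h x) + pint p (M \<Otimes>\<^sub>M N) (\<lambda>x. h x - g n x)))"
        by (intro mult_mono pint_triangle p_ge) (auto simp del: ennreal_plus intro!: ennreal_leI)
      also have "\<dots> \<le> ennreal (\<bar>C\<bar> + 1) * (ennreal (2 powr p) * (ennreal d + ennreal d))"
        using n0[OF mn(1)] n0[OF mn(2)] pint_diff_commute[of p "M \<Otimes>\<^sub>M N" h "g n"]
        by (intro mult_left_mono add_mono) (auto intro: less_imp_le)
      also have "\<dots> = ennreal ((\<bar>C\<bar> + 1) * (2 powr p * (d + d)))"
        using d by (simp add: ennreal_mult flip: ennreal_plus)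
      also have "(\<bar>C\<bar> + 1) * (2 powr p * (d + d)) = e"
      proof -
        have ne: "2 * 2 powr p * (\<bar>C\<bar> + 1) \<noteq> 0" by (simp add: add_nonneg_eq_0_iff)
        have "(\<bar>C\<bar> + 1) * (2 powr p * (d + d)) = 2 * 2 powr p * (\<bar>C\<bar> + 1) * d"
          by (simp add: algebra_simps)
        then show ?thesis
          unfolding d_def by (simp only: times_divide_eq_right nonzero_mult_div_cancel_left[OF ne])
      qed
      finally show "pint p (M \<Otimes>\<^sub>M N) (\<lambda>x. u m x - u n x) \<le> ennreal e" .
    qed
  qed
  from MN.Lp_complete[OF uLp p_ge(2) this]
  obtain v where v: "v \<in> Lp p (M \<Otimes>\<^sub>M N)"
    and uv: "(\<lambda>n. pint p (M \<Otimes>\<^sub>M N) (\<lambda>x. u n x - v x)) \<longlonglongrightarrow> 0" by blast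
  note [measurable] = Lp_measurable[OF v]
  have [measurable]: "(\<lambda>w. pint p M (\<lambda>z. g n (z, w) - h (z, w))) \<in> borel_measurable N"
    "(\<lambda>w. pint p M (\<lambda>z. u n (z, w) - v (z, w))) \<in> borel_measurable N" for n
    using pint_slice_measurable[of "\<lambda>x. g n x - h x"] pint_slice_measurable[of "\<lambda>x. u n x - v x"] by auto
  \<comment> \<open>An upper bound for the error on the slice w, going through \<open>u n\<close>.
    Convergence in the product controls these bounds only after integration in w. Their infimum over
    n replaces an a.e. convergent subsequence: its integral lies below a null sequence, so the
    infimum vanishes for almost every w.\<close>
  let ?c = "\<lambda>n w. ennreal (2 powr p) * (1 * pint p M (\<lambda>z. u n (z, w) - v (z, w)) +
      ennreal C * pint p M (\<lambda>z. g n (z, w) - h (z, w)))"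
  have "AE w in N. (INF n. ?c n w) = 0"
  proof -
    have "(\<integral>\<^sup>+w. (INF n. ?c n w) \<partial>N) \<le> ennreal (2 powr p) * (1 * pint p (M \<Otimes>\<^sub>M N) (\<lambda>x. u n x - v x) +
      ennreal C * pint p (M \<Otimes>\<^sub>M N) (\<lambda>x. g n x - h x))" for n
    proof -
      have "(\<integral>\<^sup>+w. (INF n. ?c n w) \<partial>N) \<le> (\<integral>\<^sup>+w. ?c n w \<partial>N)"
        by (intro nn_integral_mono INF_lower) auto
      also have "\<dots> = ennreal (2 powr p) * (1 * pint p (M \<Otimes>\<^sub>M N) (\<lambda>x. u n x - v x) +
          ennreal C * pint p (M \<Otimes>\<^sub>M N) (\<lambda>x. g n x - h x))"
        by (simp add: nn_integral_cmult nn_integral_add pint_pair_snd)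
      finally show ?thesis .
    qed
    then have "(\<integral>\<^sup>+w. (INF n. ?c n w) \<partial>N) \<le> 0"
      by (intro LIMSEQ_le_const[OF ennreal_tendsto_0_lincomb[OF uv lim, where a=1 and b="ennreal C" and c="ennreal (2 powr p)"]]) auto
    then show ?thesis by (subst (asm) le_zero_eq, subst (asm) nn_integral_0_iff_AE) auto
  qed
  moreover have "AE w in N. \<forall>n. (\<lambda>z. g n (z, w)) \<in> Lp p M \<and> (AE z in M. u n (z, w) = S (\<lambda>z. g n (z, w)) z)"
    using u(1) by (simp add: AE_all_countable acts_def)
  ultimately have "AE w in N. AE z in M. v (z, w) = S (\<lambda>z. h (z, w)) z"
    using Lp_slice[OF h] AE_space
  proof eventually_elim
    case (elim w)
    note [measurable] = S_measurable[OF elim(3)] and w [measurable] = elim(4)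
    have "pint p M (\<lambda>z. S (\<lambda>z. h (z, w)) z - v (z, w)) \<le> ?c n w" for n
    proof -
      have [measurable]: "S (\<lambda>z. g n (z, w)) \<in> borel_measurable M" using elim(2) by (intro S_measurable) auto
      have "pint p M (\<lambda>z. S (\<lambda>z. h (z, w)) z - v (z, w)) \<le> ennreal (2 powr p) *
          (pint p M (\<lambda>z. S (\<lambda>z. h (z, w)) z - u n (z, w)) + pint p M (\<lambda>z. u n (z, w) - v (z, w)))"
        by (intro pint_triangle p_ge) measurable
      also have "pint p M (\<lambda>z. S (\<lambda>z. h (z, w)) z - u n (z, w)) =
          pint p M (\<lambda>z. S (\<lambda>z. g n (z, w)) z - S (\<lambda>z. h (z, w)) z)"
        by (subst pint_diff_commute, rule pint_cong_AE) (use elim(2) in auto)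
      also have "\<dots> \<le> ennreal C * pint p M (\<lambda>z. g n (z, w) - h (z, w))"
        using elim by (intro S_diff_bound) auto
      finally show ?thesis by (simp add: add.commute mult_left_mono)
    qed
    then have "pint p M (\<lambda>z. S (\<lambda>z. h (z, w)) z - v (z, w)) \<le> (INF n. ?c n w)"
      by (intro INF_greatest)
    then have "pint p M (\<lambda>z. S (\<lambda>z. h (z, w)) z - v (z, w)) = 0"
      using elim(1) by simp
    then show ?case
      by (subst (asm) pint_eq_0_iff) auto
  qed
  then have "acts h v"
    unfolding acts_def using Lp_slice[OF h] v by auto
  moreover have "AE z in M. S (avg \<eta> h) z = avg \<eta> v z" if \<eta>: "bounded_weight \<eta>" for \<eta>
  proof -
    obtain K where K: "0 \<le> K"
      "\<And>f g. f \<in> Lp p (M \<Otimes>\<^sub>M N) \<Longrightarrow> g \<in> Lp p (M \<Otimes>\<^sub>M N) \<Longrightarrow>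
         pint p M (\<lambda>z. avg \<eta> f z - avg \<eta> g z) \<le> ennreal K * pint p (M \<Otimes>\<^sub>M N) (\<lambda>x. f x - g x)"
      using avg_diff_bound[OF \<eta>] by metis
    note [measurable] = avg_measurable[OF _ \<eta>] S_measurable[OF avg_Lp[OF h \<eta>]] S_measurable[OF avg_Lp[OF g \<eta>]]
    \<comment> \<open>The left side does not involve n, while the right side is a null sequence:
      averaging costs a factor K, and \<open>S\<close> after averaging a factor C K.\<close>
    have "pint p M (\<lambda>z. S (avg \<eta> h) z - avg \<eta> v z) \<le> ennreal (2 powr p) *
        (ennreal K * pint p (M \<Otimes>\<^sub>M N) (\<lambda>x. u n x - v x) +
         ennreal C * ennreal K * pint p (M \<Otimes>\<^sub>M N) (\<lambda>x. g n x - h x))" for n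
    proof -
      have "pint p M (\<lambda>z. S (avg \<eta> h) z - avg \<eta> v z) \<le> ennreal (2 powr p) *
          (pint p M (\<lambda>z. S (avg \<eta> h) z - avg \<eta> (u n) z) + pint p M (\<lambda>z. avg \<eta> (u n) z - avg \<eta> v z))"
        by (intro pint_triangle p_ge) measurable
      also have "pint p M (\<lambda>z. S (avg \<eta> h) z - avg \<eta> (u n) z) =
          pint p M (\<lambda>z. S (avg \<eta> (g n)) z - S (avg \<eta> h) z)"
        by (subst pint_diff_commute, rule pint_cong_AE) (use u(2)[OF \<eta>, of n] in auto)
      also have "\<dots> \<le> ennreal C * pint p M (\<lambda>z. avg \<eta> (g n) z - avg \<eta> h z)"
        by (intro S_diff_bound avg_Lp g h \<eta>)
      also have "pint p M (\<lambda>z. avg \<eta> (g n) z - avg \<eta> h z) \<le> ennreal K * pint p (M \<Otimes>\<^sub>M N) (\<lambda>x. g n x - h x)"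
        by (intro K g h)
      also have "pint p M (\<lambda>z. avg \<eta> (u n) z - avg \<eta> v z) \<le> ennreal K * pint p (M \<Otimes>\<^sub>M N) (\<lambda>x. u n x - v x)"
        by (intro K uLp v)
      finally show ?thesis
        by (simp add: mult_left_mono mult.assoc add.commute)
    qed
    then have "pint p M (\<lambda>z. S (avg \<eta> h) z - avg \<eta> v z) \<le> 0"
      by (intro LIMSEQ_le_const[OF ennreal_tendsto_0_lincomb[OF uv lim,
            where a="ennreal K" and b="ennreal C * ennreal K" and c="ennreal (2 powr p)"]])
         (auto simp: ennreal_mult_less_top)
    then show ?thesis
      by (subst (asm) le_zero_eq, subst (asm) pint_eq_0_iff) auto
  qed
  ultimately show ?thesis using h by (auto simp: commutes_with_avg_def)
qed

end

text \<open>The factor 2 in the hypothesis is the one provided by approximation with simple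
  functions; together with h itself it gives the majorant \<open>3 * h\<close>.\<close>

lemma pint_dominated_convergence:
  fixes h :: "'a \<Rightarrow> complex"
  assumes g [measurable]: "\<And>n. g n \<in> borel_measurable M" and h: "h \<in> Lp p M" and p: "0 < p"
    and lim: "\<And>x. x \<in> space M \<Longrightarrow> (\<lambda>n. g n x) \<longlonglongrightarrow> h x"
    and le: "\<And>n x. x \<in> space M \<Longrightarrow> norm (g n x) \<le> 2 * norm (h x)"
  shows "(\<lambda>n. pint p M (\<lambda>x. g n x - h x)) \<longlonglongrightarrow> 0"
proof -
  note [measurable] = Lp_measurable[OF h]
  have "(\<lambda>n. pint p M (\<lambda>x. g n x - h x)) \<longlonglongrightarrow> (\<integral>\<^sup>+x. 0 \<partial>M)"
    unfolding pint_def
  proof (rule nn_integral_dominated_convergence[where w="\<lambda>x. ennreal (norm (3 * h x) powr p)"])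
    have "pint p M (\<lambda>x. 3 * h x) < \<infinity>" using Lp_cmult[OF h, of 3] by (simp add: Lp_def)
    then show "(\<integral>\<^sup>+x. ennreal (norm (3 * h x) powr p) \<partial>M) < \<infinity>" by (simp add: pint_def)
    show "AE x in M. ennreal (norm (g n x - h x) powr p) \<le> ennreal (norm (3 * h x) powr p)" for n
    proof (intro AE_I2 ennreal_leI powr_mono2)
      fix x assume "x \<in> space M"
      then show "norm (g n x - h x) \<le> norm (3 * h x)"
        using le[of x n] norm_triangle_ineq4[of "g n x" "h x"] by (simp add: norm_mult)
    qed (use p in auto)
    show "AE x in M. (\<lambda>n. ennreal (norm (g n x - h x) powr p)) \<longlonglongrightarrow> 0"
    proof (rule AE_I2)
      fix x assume "x \<in> space M"
      then have "(\<lambda>n. norm (g n x - h x)) \<longlonglongrightarrow> 0"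
        using lim by (intro tendsto_norm_zero) (simp add: LIM_zero)
      then have "(\<lambda>n. norm (g n x - h x) powr p) \<longlonglongrightarrow> 0"
        using p by (intro tendsto_zero_powrI[where b=p]) auto
      then show "(\<lambda>n. ennreal (norm (g n x - h x) powr p)) \<longlonglongrightarrow> 0"
        using tendsto_ennrealI by fastforce
    qed
  qed auto
  then show ?thesis by simp
qed

section \<open>From rectangles to all of \<open>L\<^sup>p\<close> on the product\<close>

context bounded_Lp_operator_pair
begin

text \<open>Every slice and every average of this tensor product is a constant multiple of
  \<open>indicator A\<close>, so both claims reduce to homogeneity of \<open>S\<close>.\<close>

lemma commutes_with_avg_rectangle:
  assumes A: "A \<in> sets M" and B: "B \<in> sets N"
  shows "commutes_with_avg (indicator (A \<times> B))"
proof -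
  note [measurable] = A B
  have A_Lp: "indicator A \<in> Lp p M"
    by (rule M.Lp_bounded[where B=1]) (auto simp: p_ge indicator_def)
  have AB_Lp: "indicator (A \<times> B) \<in> Lp p (M \<Otimes>\<^sub>M N)"
    by (rule MN.Lp_bounded[where B=1]) (auto simp: p_ge indicator_def)
  define u where "u x = S (indicator A) (fst x) * indicator B (snd x)" for x
  note [measurable] = S_measurable[OF A_Lp]
  have u: "u \<in> Lp p (M \<Otimes>\<^sub>M N)"
  proof -
    have "pint p (M \<Otimes>\<^sub>M N) u \<le> pint p (M \<Otimes>\<^sub>M N) (\<lambda>x. S (indicator A) (fst x))"
      by (intro pint_mono_AE p_ge AE_I2) (auto simp: u_def norm_mult indicator_def)
    also have "\<dots> = (\<integral>\<^sup>+w. pint p M (S (indicator A)) \<partial>N)"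
      by (subst pint_pair_snd) auto
    also have "\<dots> < \<infinity>"
      using S_Lp[OF A_Lp] by (auto simp: Lp_def ennreal_mult_less_top N.emeasure_eq_measure)
    finally show ?thesis by (auto simp: Lp_def u_def[abs_def])
  qed
  have eq: "(\<lambda>z. indicator (A \<times> B) (z, w)) = (\<lambda>z. indicator B w * indicator A z :: complex)" for w
    by (auto simp: indicator_def)
  have "acts (indicator (A \<times> B)) u"
    unfolding acts_def eq
  proof (rule conjI[OF u], rule AE_I2, rule conjI)
    fix w
    show "(\<lambda>z. indicator B w * indicator A z) \<in> Lp p M"
      by (intro Lp_cmult A_Lp)
    show "AE z in M. u (z, w) = S (\<lambda>z. indicator B w * indicator A z) z"
      using S_cmult[OF A_Lp, of "indicator B w"] by eventually_elim (simp add: u_def)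
  qed
  moreover have "AE z in M. S (avg \<eta> (indicator (A \<times> B))) z = avg \<eta> u z" for \<eta>
  proof -
    define c where "c = (\<integral>w. indicator B w * \<eta> w \<partial>N)"
    have "avg \<eta> (indicator (A \<times> B)) = (\<lambda>z. c * indicator A z)"
      by (rule ext) (auto simp: avg_def c_def indicator_def)
    moreover have "avg \<eta> u z = c * S (indicator A) z" for z
      by (simp add: avg_def u_def c_def mult.assoc)
    ultimately show ?thesis using S_cmult[OF A_Lp, of c] by simp
  qed
  ultimately show ?thesis using AB_Lp by (auto simp: commutes_with_avg_def)
qed

lemma commutes_with_avg_sum:
  assumes "finite I" "\<And>i. i \<in> I \<Longrightarrow> commutes_with_avg (f i)"
  shows "commutes_with_avg (\<lambda>x. \<Sum>i\<in>I. f i x)"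
  using assms
proof induction
  case empty
  show ?case using commutes_with_avg_cmult[OF commutes_with_avg_rectangle[of "{}" "{}"], of 0] by simp
qed (auto intro: commutes_with_avg_add)

text \<open>Dynkin's argument from the intersection-stable generator of rectangles. Complements use
  linearity; for a disjoint union the partial sums converge in \<open>L\<^sup>p\<close> by dominated
  convergence.\<close>

lemma commutes_with_avg_indicator:
  assumes "E \<in> sets (M \<Otimes>\<^sub>M N)"
  shows "commutes_with_avg (indicator E)"
  using Int_stable_pair_measure_generator pair_measure_closed assms
  unfolding sets_pair_measure
proof (induct rule: sigma_sets_induct_disjoint)
  case (basic A)
  then show ?case by (auto intro: commutes_with_avg_rectangle)
next
  case empty
  show ?case using commutes_with_avg_rectangle[OF sets.empty_sets sets.empty_sets] by (simp only: Sigma_empty1)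
next
  case (compl A)
  have "commutes_with_avg (\<lambda>x. indicator (space M \<times> space N) x + (-1) * indicator A x)"
    by (intro commutes_with_avg_add commutes_with_avg_cmult commutes_with_avg_rectangle compl) auto
  then show ?case
    by (rule commutes_with_avg_cong) (auto simp: space_pair_measure indicator_def)
next
  case (union A)
  have A [measurable]: "A i \<in> sets (M \<Otimes>\<^sub>M N)" for i
    using union(2) by (auto simp: sets_pair_measure)
  have eq: "(\<Sum>i<n. indicator (A i) x) = (indicator (\<Union>i<n. A i) x :: complex)" for n x
    using union(1) by (subst indicator_UN_disjoint) (auto simp: disjoint_family_on_def)
  show ?case
  proof (rule commutes_with_avg_limit)
    show "commutes_with_avg (\<lambda>x. \<Sum>i<n. indicator (A i) x)" for n
      by (intro commutes_with_avg_sum union) auto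
    show *: "indicator (\<Union>i. A i) \<in> Lp p (M \<Otimes>\<^sub>M N)"
      by (rule MN.Lp_bounded[where B=1]) (auto simp: p_ge indicator_def)
    have "(\<lambda>n. pint p (M \<Otimes>\<^sub>M N) (\<lambda>x. indicator (\<Union>i<n. A i) x - indicator (\<Union>i. A i) x :: complex)) \<longlonglongrightarrow> 0"
    proof (rule pint_dominated_convergence[OF _ *])
      show "(\<lambda>n. indicator (\<Union>i<n. A i) x) \<longlonglongrightarrow> (indicator (\<Union>i. A i) x :: complex)" for x
        by (rule LIMSEQ_indicator_UN)
    qed (use p in \<open>auto simp: indicator_def\<close>)
    then show "(\<lambda>n. pint p (M \<Otimes>\<^sub>M N) (\<lambda>x. (\<Sum>i<n. indicator (A i) x) - indicator (\<Union>i. A i) x :: complex)) \<longlonglongrightarrow> 0"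
      by (simp only: eq)
  qed
qed

lemma commutes_with_avg_all:
  assumes f: "f \<in> Lp p (M \<Otimes>\<^sub>M N)"
  shows "commutes_with_avg f"
proof -
  obtain s where s: "\<And>i. simple_function (M \<Otimes>\<^sub>M N) (s i)"
    and lim: "\<And>x. x \<in> space (M \<Otimes>\<^sub>M N) \<Longrightarrow> (\<lambda>i. s i x) \<longlonglongrightarrow> f x"
    and le: "\<And>i x. x \<in> space (M \<Otimes>\<^sub>M N) \<Longrightarrow> norm (s i x) \<le> 2 * norm (f x)"
    using borel_measurable_implies_sequence_metric[OF Lp_measurable[OF f], of 0] by auto metis
  show ?thesis
  proof (rule commutes_with_avg_limit[OF _ f])
    fix i
    let ?X = "space (M \<Otimes>\<^sub>M N)"
    have fin: "finite (s i ` ?X)" using s[of i] by (auto simp: simple_function_def)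
    have "commutes_with_avg (\<lambda>x. \<Sum>y\<in>s i ` ?X. y * indicator (s i -` {y} \<inter> ?X) x)"
      using s[of i] by (intro commutes_with_avg_sum fin commutes_with_avg_cmult commutes_with_avg_indicator) (auto simp: simple_function_def)
    then show "commutes_with_avg (s i)"
    proof (rule commutes_with_avg_cong)
      fix x assume x: "x \<in> ?X"
      have "(\<Sum>y\<in>s i ` ?X. y * indicator (s i -` {y} \<inter> ?X) x) = (\<Sum>y\<in>s i ` ?X. if s i x = y then y else 0)"
        using x by (intro sum.cong) (auto simp: indicator_def)
      also have "\<dots> = s i x" using x fin by simp
      finally show "(\<Sum>y\<in>s i ` ?X. y * indicator (s i -` {y} \<inter> ?X) x) = s i x" .
    qed
  next
    show "(\<lambda>n. pint p (M \<Otimes>\<^sub>M N) (\<lambda>x. s n x - f x)) \<longlonglongrightarrow> 0"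
      using p s by (intro pint_dominated_convergence[OF _ f] lim le borel_measurable_simple_function) auto
  qed
qed

lemma acts_exists:
  assumes "f \<in> Lp p (M \<Otimes>\<^sub>M N)"
  shows "\<exists>u. acts f u"
  using commutes_with_avg_all[OF assms] by (auto simp: commutes_with_avg_def)

text \<open>The approximation produced only some u. Any other one agrees with it almost everywhere
  on the product, hence has the same averages for almost every z.\<close>

lemma S_avg:
  assumes f: "f \<in> Lp p (M \<Otimes>\<^sub>M N)" and u: "acts f u" and \<eta>: "bounded_weight \<eta>"
  shows "AE z in M. S (avg \<eta> f) z = avg \<eta> u z"
proof -
  obtain v where v: "acts f v" "AE z in M. S (avg \<eta> f) z = avg \<eta> v z"
    using commutes_with_avg_all[OF f] \<eta> by (auto simp: commutes_with_avg_def)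
  have uv: "u \<in> Lp p (M \<Otimes>\<^sub>M N)" "v \<in> Lp p (M \<Otimes>\<^sub>M N)" using u v by (auto simp: acts_def)
  note [measurable] = acts_measurable[OF u] acts_measurable[OF v(1)] bounded_weight_measurable[OF \<eta>]
  have "AE z in M. AE w in N. u (z, w) = v (z, w)"
    using MN.AE_pair[OF acts_unique[OF u v(1) f]] .
  then have "AE z in M. avg \<eta> u z = avg \<eta> v z"
    using AE_space
  proof eventually_elim
    case (elim z)
    then have [measurable]: "z \<in> space M" by simp
    show ?case
      unfolding avg_def by (rule integral_cong_AE) (use elim in auto)
  qed
  then show ?thesis using v(2) by eventually_elim simp
qed

end

section \<open>Smooth functions\<close>

lemma ck_const: "ck k (\<lambda>x. c)"
proof (induction k arbitrary: c)
  case (Suc k)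
  show ?case
    unfolding ck.simps by (rule exI[of _ "\<lambda>x v. 0"]) (use Suc in auto)
qed auto

lemma ck_SucI:
  assumes "\<And>x. (f has_derivative f' x) (at x)" "\<And>v. ck k (\<lambda>x. f' x v)"
  shows "ck (Suc k) f"
  using assms by auto

lemma ck_continuous: "ck k f \<Longrightarrow> continuous_on UNIV f"
proof (cases k)
  case (Suc n)
  assume "ck k f"
  then obtain f' where "\<And>x. (f has_derivative f' x) (at x)" using Suc by auto
  then show ?thesis
    by (intro continuous_at_imp_continuous_on ballI has_derivative_continuous)
qed auto

text \<open>\<open>ck (Suc k)\<close> does not mention \<open>ck k\<close>. The product rule needs
  the lower order, since each factor also occurs undifferentiated.\<close>

lemma ck_Suc_imp: "ck (Suc k) f \<Longrightarrow> ck k f"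
proof (induction k arbitrary: f)
  case 0
  then show ?case by (metis ck.simps(1) ck_continuous)
next
  case (Suc k)
  from Suc.prems obtain f' where f': "\<And>x. (f has_derivative f' x) (at x)" "\<And>v. ck (Suc k) (\<lambda>x. f' x v)"
    by (subst (asm) ck.simps) blast
  then show ?case using Suc.IH by (intro ck_SucI) auto
qed

lemma ck_add: "ck k f \<Longrightarrow> ck k g \<Longrightarrow> ck k (\<lambda>x. f x + g x)"
proof (induction k arbitrary: f g)
  case (Suc k)
  from Suc.prems obtain f' g' where
    f': "\<And>x. (f has_derivative f' x) (at x)" "\<And>v. ck k (\<lambda>x. f' x v)" and
    g': "\<And>x. (g has_derivative g' x) (at x)" "\<And>v. ck k (\<lambda>x. g' x v)"
    by auto
  show ?case
    by (rule ck_SucI, rule has_derivative_add[OF f'(1) g'(1)]) (intro Suc.IH f' g')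
qed (auto intro: continuous_intros)

lemma ck_mult: "ck k f \<Longrightarrow> ck k g \<Longrightarrow> ck k (\<lambda>x. f x * g x)"
proof (induction k arbitrary: f g)
  case (Suc k)
  from Suc.prems obtain f' g' where
    f': "\<And>x. (f has_derivative f' x) (at x)" "\<And>v. ck k (\<lambda>x. f' x v)" and
    g': "\<And>x. (g has_derivative g' x) (at x)" "\<And>v. ck k (\<lambda>x. g' x v)"
    by auto
  show ?case
    by (rule ck_SucI, rule has_derivative_mult[OF f'(1) g'(1)])
       (intro ck_add Suc.IH f' g' Suc.prems[THEN ck_Suc_imp])
qed (auto intro: continuous_intros)

lemma ck_prod:
  "finite I \<Longrightarrow> (\<And>i. i \<in> I \<Longrightarrow> ck k (f i)) \<Longrightarrow> ck k (\<lambda>x. \<Prod>i\<in>I. f i x)"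
  by (induction I rule: finite_induct) (auto intro: ck_const ck_mult)

lemma ck_compose_affine:
  assumes L: "bounded_linear L"
  shows "ck k f \<Longrightarrow> ck k (\<lambda>x. f (L x + b))"
proof (induction k arbitrary: f)
  case 0
  then show ?case
    by (auto intro!: continuous_on_compose2[of UNIV f] continuous_intros linear_continuous_on[OF L])
next
  case (Suc k)
  then obtain f' where f': "\<And>x. (f has_derivative f' x) (at x)" "\<And>v. ck k (\<lambda>x. f' x v)"
    by auto
  have "((\<lambda>x. L x + b) has_derivative L) (at x)" for x
    by (auto intro!: derivative_eq_intros bounded_linear_imp_has_derivative[OF L])
  from has_derivative_compose[OF this f'(1)]
  have "((\<lambda>x. f (L x + b)) has_derivative (\<lambda>v. f' (L x + b) (L v))) (at x)" for x .
  then show ?case by (rule ck_SucI) (intro Suc.IH f')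
qed

text \<open>
  The family is closed under differentiation, which makes \<open>flat_fun c 0\<close>, i.e. \<open>exp (- c / t)\<close>
  extended by zero, smooth.
\<close>

definition flat_fun :: "real \<Rightarrow> nat \<Rightarrow> real \<Rightarrow> real" where
  "flat_fun c k t = (if 0 < t then exp (- c / t) / t ^ k else 0)"

text \<open>With s = 1 / t this is the decay of s^k / exp (c s) at infinity.\<close>

lemma flat_fun_tendsto_0:
  assumes "0 < c"
  shows "((\<lambda>t. exp (- c / t) / t ^ k) \<longlongrightarrow> 0) (at_right (0::real))"
proof -
  have "((\<lambda>s. s ^ k / exp (c * s)) \<longlongrightarrow> 0) at_top"
  proof -
    have "((\<lambda>s. (1 / c) ^ k * ((c * s) ^ k / exp (c * s))) \<longlongrightarrow> (1 / c) ^ k * 0) at_top"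
      using assms
      by (intro tendsto_mult tendsto_const filterlim_compose[OF tendsto_power_div_exp_0]
          filterlim_tendsto_pos_mult_at_top[OF tendsto_const _ filterlim_ident]) auto
    then show ?thesis using assms by (simp add: power_mult_distrib power_divide)
  qed
  then have "((\<lambda>t. inverse t ^ k / exp (c * inverse t)) \<longlongrightarrow> 0) (at_right (0::real))"
    by (rule filterlim_compose[OF _ filterlim_inverse_at_top_right])
  then show ?thesis
    by (simp add: field_simps exp_minus power_inverse)
qed

lemma flat_fun_has_derivative:
  assumes c: "0 < c"
  shows "(flat_fun c k has_real_derivative c * flat_fun c (k + 2) t - real k * flat_fun c (k + 1) t) (at t)"
proof -
  consider "0 < t" | "t < 0" | "t = 0" by linarith
  then show ?thesis
  proof cases
    case 1
    have "((\<lambda>t. exp (- c / t) / t ^ k) has_real_derivative c * flat_fun c (k + 2) t - real k * flat_fun c (k + 1) t) (at t)"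
    proof (cases k)
      case 0
      then show ?thesis using 1
        by (auto intro!: derivative_eq_intros simp: flat_fun_def power2_eq_square field_simps)
    next
      case (Suc n)
      have "((\<lambda>t. exp (- c / t) / t ^ k) has_real_derivative
          ((exp (- c / t) * (c / (t * t))) * t ^ k - exp (- c / t) * (real k * t ^ n)) / (t ^ k * t ^ k)) (at t)"
        using 1 Suc by (auto intro!: derivative_eq_intros simp: power2_eq_square field_simps) (cases n, auto)
      moreover have "((exp (- c / t) * (c / (t * t))) * t ^ k - exp (- c / t) * (real k * t ^ n)) / (t ^ k * t ^ k) =
          c * flat_fun c (k + 2) t - real k * flat_fun c (k + 1) t"
        using 1 Suc by (simp add: flat_fun_def field_simps power2_eq_square)
      ultimately show ?thesis by simp
    qed
    moreover have "\<forall>\<^sub>F x in nhds t. flat_fun c k x = exp (- c / x) / x ^ k"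
      using eventually_nhds_in_open[of "{0<..}" t] 1 by (auto elim!: eventually_mono simp: flat_fun_def)
    ultimately show ?thesis
      by (subst DERIV_cong_ev[OF refl _ refl]) auto
  next
    case 2
    have "\<forall>\<^sub>F x in nhds t. flat_fun c k x = 0"
      using eventually_nhds_in_open[of "{..<0}" t] 2 by (auto elim!: eventually_mono simp: flat_fun_def)
    then show ?thesis
      using 2 by (subst DERIV_cong_ev[OF refl _ refl]) (auto simp: flat_fun_def)
  next
    case 3
    \<comment> \<open>Dividing by h > 0 merely raises the exponent by one, so the quotient from the
      right is again a flat function tending to 0; from the left it is 0.\<close>
    have "((\<lambda>h. (flat_fun c k (0 + h) - flat_fun c k 0) / h) \<longlongrightarrow> 0) (at 0)"
    proof (rule filterlim_split_at)
      have "\<forall>\<^sub>F h in at_left 0. (flat_fun c k (0 + h) - flat_fun c k 0) / h = 0"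
        by (auto simp: flat_fun_def eventually_at_filter)
      then show "((\<lambda>h. (flat_fun c k (0 + h) - flat_fun c k 0) / h) \<longlongrightarrow> 0) (at_left 0)"
        by (rule tendsto_eventually)
      have "\<forall>\<^sub>F h in at_right 0. exp (- c / h) / h ^ Suc k = (flat_fun c k (0 + h) - flat_fun c k 0) / h"
        by (auto simp: flat_fun_def eventually_at_filter field_simps)
      then show "((\<lambda>h. (flat_fun c k (0 + h) - flat_fun c k 0) / h) \<longlongrightarrow> 0) (at_right 0)"
        by (rule Lim_transform_eventually[OF flat_fun_tendsto_0[OF c]])
    qed
    then show ?thesis
      using 3 by (simp add: DERIV_def flat_fun_def)
  qed
qed

text \<open>The exponent k stays arbitrary in the induction because differentiation leads to the
  exponents k + 1 and k + 2.\<close>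

lemma ck_flat_fun:
  fixes v :: "'a::euclidean_space"
  assumes c: "0 < c"
  shows "ck n (\<lambda>x. complex_of_real (flat_fun c k (x \<bullet> v + b)))"
proof (induction n arbitrary: k)
  case 0
  have "continuous_on UNIV (flat_fun c k)"
    using flat_fun_has_derivative[OF c] by (meson DERIV_isCont continuous_at_imp_continuous_on)
  then show ?case
    by (auto intro!: continuous_intros continuous_on_compose2[of UNIV "flat_fun c k"])
next
  case (Suc n)
  let ?d = "\<lambda>x. c * flat_fun c (k + 2) (x \<bullet> v + b) - real k * flat_fun c (k + 1) (x \<bullet> v + b)"
  have inner: "((\<lambda>x. x \<bullet> v + b) has_derivative (\<lambda>w. w \<bullet> v)) (at x)" for x
    by (auto intro!: derivative_eq_intros)
  have "((\<lambda>x. flat_fun c k (x \<bullet> v + b)) has_derivative (\<lambda>w. ?d x * (w \<bullet> v))) (at x)" for x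
    using has_derivative_compose[OF inner flat_fun_has_derivative[OF c, unfolded has_field_derivative_def]]
    by (simp add: mult.commute)
  from has_derivative_of_real[OF this]
  have der: "((\<lambda>x. complex_of_real (flat_fun c k (x \<bullet> v + b))) has_derivative
      (\<lambda>w. complex_of_real (?d x * (w \<bullet> v)))) (at x)" for x .
  show ?case
  proof (rule ck_SucI[OF der])
    fix w
    have "ck n (\<lambda>x. of_real (c * (w \<bullet> v)) * of_real (flat_fun c (k + 2) (x \<bullet> v + b)) +
        of_real (- real k * (w \<bullet> v)) * complex_of_real (flat_fun c (k + 1) (x \<bullet> v + b)))"
      by (intro ck_add ck_mult ck_const Suc)
    then show "ck n (\<lambda>x. complex_of_real (?d x * (w \<bullet> v)))"
      by (simp add: algebra_simps)
  qed
qed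

text \<open>In each coordinate the factors are flat at the left and at the right end of the box. The
  parameter c measures how slowly the function rises: as c tends to 0 it tends to the indicator of
  the open box.\<close>

definition box_bump :: "'a::euclidean_space \<Rightarrow> 'a \<Rightarrow> real \<Rightarrow> 'a \<Rightarrow> complex" where
  "box_bump a b c x =
     (\<Prod>i\<in>Basis. complex_of_real (flat_fun c 0 (x \<bullet> i + (- (a \<bullet> i)))) *
        complex_of_real (flat_fun c 0 (x \<bullet> (- i) + b \<bullet> i)))"

lemma ck_box_bump: "0 < c \<Longrightarrow> ck k (box_bump a b c)"
  unfolding box_bump_def[abs_def] by (intro ck_prod ck_mult ck_flat_fun) auto

lemma box_bump_eq_0: "x \<notin> box a b \<Longrightarrow> box_bump a b c x = 0"
proof -
  assume "x \<notin> box a b"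
  then obtain i where "i \<in> Basis" "x \<bullet> i \<le> a \<bullet> i \<or> b \<bullet> i \<le> x \<bullet> i"
    by (auto simp: mem_box not_less)
  then show ?thesis
    unfolding box_bump_def by (intro prod_zero bexI[of _ i]) (auto simp: flat_fun_def)
qed

lemma test_function_box_bump:
  assumes "0 < c" "cbox a b \<subseteq> U"
  shows "test_function U (box_bump a b c)"
  unfolding test_function_def
proof (intro conjI allI exI)
  show "x \<notin> cbox a b \<longrightarrow> box_bump a b c x = 0" for x
    using box_bump_eq_0 box_subset_cbox by blast
qed (use assms in \<open>auto intro: ck_box_bump\<close>)

lemma norm_box_bump_le: "0 < c \<Longrightarrow> norm (box_bump a b c x) \<le> 1"
proof -
  assume "0 < c"
  then have *: "0 \<le> flat_fun c 0 t \<and> flat_fun c 0 t \<le> 1" for t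
    by (auto simp: flat_fun_def)
  show ?thesis
    unfolding box_bump_def prod_norm[symmetric] norm_mult norm_of_real
    using * by (intro prod_le_1) (auto intro: mult_le_one)
qed

lemma box_bump_tendsto_indicator:
  "(\<lambda>n. box_bump a b (1 / real (Suc n)) x) \<longlonglongrightarrow> indicator (box a b) x"
proof (cases "x \<in> box a b")
  case True
  have *: "(\<lambda>n. complex_of_real (flat_fun (1 / real (Suc n)) 0 t)) \<longlonglongrightarrow> 1" if "0 < t" for t
  proof -
    have "(\<lambda>n. complex_of_real (exp (- (1 / real (Suc n)) / t))) \<longlonglongrightarrow> of_real (exp (- 0 / t))"
      by (intro tendsto_of_real tendsto_exp tendsto_divide tendsto_minus tendsto_const lim_1_over_n[THEN LIMSEQ_Suc])
         (use that in auto)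
    then show ?thesis using that by (simp add: flat_fun_def)
  qed
  have "(\<lambda>n. box_bump a b (1 / real (Suc n)) x) \<longlonglongrightarrow> (\<Prod>i\<in>(Basis::'a set). 1 * 1)"
    unfolding box_bump_def using True
    by (intro tendsto_prod tendsto_mult *) (auto simp: mem_box)
  then show ?thesis using True by simp
qed (simp add: box_bump_eq_0)

text \<open>Open boxes are an intersection-stable generator of the Borel sets, so the integral of f
  over every Borel set vanishes. The integral over the whole space is a separate hypothesis because
  complements are subtracted from it.\<close>

lemma AE_eq_0_if_box_integrals:
  fixes f :: "'a::euclidean_space \<Rightarrow> complex"
  assumes f: "integrable lborel f"
    and UNIV: "(LINT x|lborel. f x) = 0"
    and box: "\<And>a b. (LINT x|lborel. indicator (box a b) x *\<^sub>R f x) = 0"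
  shows "AE x in lborel. f x = 0"
proof (rule sigma_finite_measure.density_zero[OF sigma_finite_lborel f])
  fix A :: "'a set" assume "A \<in> sets lborel"
  then have A: "A \<in> sigma_sets UNIV (range (\<lambda>(a, b). box a b))"
    by (simp add: borel_eq_box)
  have gen: "Int_stable (range (\<lambda>(a, b). box a b :: 'a set))" "range (\<lambda>(a, b). box a b :: 'a set) \<subseteq> Pow UNIV"
    by (auto simp: Int_stable_def box_Int_box)
  show "set_lebesgue_integral lborel A f = 0"
    using gen A
  proof (induction rule: sigma_sets_induct_disjoint)
    case (basic A)
    then show ?case using box by (auto simp: set_lebesgue_integral_def)
  next
    case empty
    show ?case by (simp add: set_lebesgue_integral_def)
  next
    case (compl A)
    then have A': "A \<in> sets lborel" by (simp add: borel_eq_box)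
    have "set_lebesgue_integral lborel (UNIV - A) f = (LINT x|lborel. f x - indicator A x *\<^sub>R f x)"
      unfolding set_lebesgue_integral_def
      by (intro Bochner_Integration.integral_cong) (auto simp: indicator_def)
    also have "\<dots> = 0"
      using compl UNIV f A' by (subst Bochner_Integration.integral_diff)
        (auto simp: set_lebesgue_integral_def intro!: integrable_mult_indicator)
    finally show ?case .
  next
    case (union A)
    have A [measurable]: "A i \<in> sets lborel" for i using union(2) by (auto simp: borel_eq_box)
    have "set_lebesgue_integral lborel (\<Union>i. A i) f = (\<Sum>i. set_lebesgue_integral lborel (A i) f)"
      using union(1) f A
      by (intro lebesgue_integral_countable_add)
         (auto simp: disjoint_family_on_def set_integrable_def intro!: integrable_mult_indicator)
    then show ?case using union by simp
  qed
qed

text \<open>The fundamental lemma of the calculus of variations. Bumps tend to the indicator of a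
  box and are bounded by 1, so integrals over boxes with closed hull in \<open>U\<close> vanish;
  hence \<open>G\<close> vanishes a.e. on each such box. Lindelof selects countably many of them
  covering \<open>U\<close>, so that the null sets may be united.\<close>

lemma AE_eq_0_if_test_integrals:
  fixes G :: "'a::euclidean_space \<Rightarrow> complex"
  assumes U: "open U" and G: "integrable (vol U) G"
    and test: "\<And>\<psi>. test_function U \<psi> \<Longrightarrow> (LINT z|vol U. G z * \<psi> z) = 0"
  shows "AE z in vol U. G z = 0"
proof -
  have [measurable]: "U \<in> sets borel" using U by simp
  define H where "H z = indicator U z *\<^sub>R G z" for z
  have H: "integrable lborel H"
    using G unfolding H_def by (subst (asm) integrable_restrict_space) auto
  have box: "(LINT z|lborel. indicator (box a b) z *\<^sub>R H z) = 0" if ab: "cbox a b \<subseteq> U" for a b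
  proof -
    have "(\<lambda>n. LINT z|lborel. box_bump a b (1 / real (Suc n)) z * H z) \<longlonglongrightarrow> (LINT z|lborel. indicator (box a b) z * H z)"
    proof (rule integral_dominated_convergence[where w="\<lambda>z. norm (H z)"])
      show "AE z in lborel. (\<lambda>n. box_bump a b (1 / real (Suc n)) z * H z) \<longlonglongrightarrow> indicator (box a b) z * H z"
        by (intro AE_I2 tendsto_mult tendsto_const box_bump_tendsto_indicator)
      show "AE z in lborel. norm (box_bump a b (1 / real (Suc n)) z * H z) \<le> norm (H z)" for n
        using norm_box_bump_le[of "1 / real (Suc n)" a b] by (auto simp: norm_mult intro!: mult_left_le_one_le)
      show "(\<lambda>z. box_bump a b (1 / real (Suc n)) z * H z) \<in> borel_measurable lborel" for n
        using ck_continuous[OF ck_box_bump[of "1 / real (Suc n)" 0 a b]] H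
        by (intro borel_measurable_times) (auto intro: borel_measurable_continuous_onI)
    qed (use H in auto)
    moreover have "(LINT z|lborel. box_bump a b (1 / real (Suc n)) z * H z) = 0" for n
    proof -
      have "(LINT z|vol U. G z * box_bump a b (1 / real (Suc n)) z) = 0"
        by (intro test test_function_box_bump ab) auto
      then show ?thesis
        by (subst (asm) integral_restrict_space) (auto simp: H_def mult_ac)
    qed
    ultimately have "(LINT z|lborel. indicator (box a b) z * H z) = 0"
      by (simp add: LIMSEQ_const_iff)
    moreover have "indicator (box a b) z *\<^sub>R H z = indicator (box a b) z * H z" for z
      by (auto simp: indicator_def)
    ultimately show ?thesis by simp
  qed
  have AE_box: "AE z in lborel. z \<in> box a b \<longrightarrow> G z = 0" if ab: "cbox a b \<subseteq> U" for a b
  proof -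
    have "AE z in lborel. indicator (box a b) z *\<^sub>R H z = 0"
    proof (rule AE_eq_0_if_box_integrals)
      show "integrable lborel (\<lambda>z. indicator (box a b) z *\<^sub>R H z)"
        using H by (intro integrable_mult_indicator) auto
      show "(LINT z|lborel. indicator (box a b) z *\<^sub>R H z) = 0" by (rule box[OF ab])
      fix c d
      obtain a' b' where a'b': "box a b \<inter> box c d = box a' b'"
        using box_Int_box by blast
      have "(LINT z|lborel. indicator (box c d) z *\<^sub>R indicator (box a b) z *\<^sub>R H z) =
          (LINT z|lborel. indicator (box a' b') z *\<^sub>R H z)"
        unfolding a'b'[symmetric] by (intro Bochner_Integration.integral_cong) (auto simp: indicator_def)
      also have "\<dots> = 0"
      \<comment> \<open>A nonempty open box has the closed box as its closure, which keeps
        \<open>cbox a' b'\<close> inside \<open>cbox a b\<close>. For an empty one the corners carry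
        no such information, but then the integral is trivially 0.\<close>
      proof (cases "box a' b' = {}")
        case False
        then have "cbox a' b' \<subseteq> cbox a b"
          using a'b' by (metis closure_box closure_mono box_subset_cbox closed_cbox closure_minimal inf.coboundedI1 order.refl)
        then show ?thesis using ab by (intro box) auto
      qed simp
      finally show "(LINT z|lborel. indicator (box c d) z *\<^sub>R indicator (box a b) z *\<^sub>R H z) = 0" .
    qed
    then show ?thesis
    proof (rule eventually_mono)
      fix z assume "indicator (box a b) z *\<^sub>R H z = 0"
      then show "z \<in> box a b \<longrightarrow> G z = 0"
        using ab box_subset_cbox[of a b] by (auto simp: H_def indicator_def split: if_splits)
    qed
  qed
  let ?F = "{box a b |a b. cbox a b \<subseteq> U}"
  obtain \<D> where \<D>: "\<D> \<subseteq> ?F" "countable \<D>" "\<Union>\<D> = \<Union>?F"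
    by (rule Lindelof[of ?F]) auto
  have cover: "z \<in> \<Union>\<D>" if "z \<in> U" for z
  proof -
    obtain e where e: "0 < e" "cball z e \<subseteq> U"
      using U \<open>z \<in> U\<close> open_contains_cball by blast
    obtain a b where ab: "z \<in> box a b" "box a b \<subseteq> ball z e"
      using rational_boxes[OF e(1)] by metis
    have "cbox a b = closure (box a b)"
      using ab(1) by (subst closure_box) auto
    also have "\<dots> \<subseteq> cball z e"
      using ab(2) ball_subset_cball by (intro closure_minimal) auto
    finally have "cbox a b \<subseteq> cball z e" .
    then show ?thesis using ab e \<D>(3) by blast
  qed
  have "AE z in lborel. \<forall>X\<in>\<D>. z \<in> X \<longrightarrow> G z = 0"
  proof (subst AE_ball_countable[OF \<D>(2)], intro ballI)
    fix X assume "X \<in> \<D>"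
    then show "AE z in lborel. z \<in> X \<longrightarrow> G z = 0" using \<D>(1) AE_box by blast
  qed
  then have "AE z in lborel. z \<in> U \<longrightarrow> G z = 0"
    by (rule eventually_mono) (use cover in blast)
  then show ?thesis
    by (subst AE_restrict_space_iff) auto
qed

section \<open>Weak derivatives in the parameter\<close>

text \<open>Fubini is applied to the pair measure, whereas weak derivatives integrate over
  \<open>U \<times> V\<close> with restricted Lebesgue measure. By sigma-finiteness it suffices to
  compare the sigma-algebras and the values on rectangles.\<close>

lemma vol_pair:
  fixes U :: "'a::euclidean_space set" and V :: "'b::euclidean_space set"
  assumes U: "U \<in> sets borel" and V: "V \<in> sets borel"
    and "finite_measure (vol U)" "finite_measure (vol V)"
  shows "vol U \<Otimes>\<^sub>M vol V = vol (U \<times> V)"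
proof (rule pair_measure_eqI)
  interpret U: finite_measure "vol U" by fact
  interpret V: finite_measure "vol V" by fact
  show "sigma_finite_measure (vol U)" "sigma_finite_measure (vol V)"
    by unfold_locales
  have UV [measurable]: "U \<times> V \<in> sets borel"
  proof -
    have "U \<times> V \<in> sets (lborel \<Otimes>\<^sub>M lborel)" using U V by (intro pair_measureI) auto
    then show ?thesis by (simp only: lborel_prod sets_lborel)
  qed
  have rect: "A \<times> B \<in> sets (vol (U \<times> V))" if "A \<in> sets (vol U)" "B \<in> sets (vol V)" for A B
  proof -
    have *: "A \<subseteq> U" "B \<subseteq> V" "A \<in> sets lborel" "B \<in> sets lborel"
      using that U V by (auto simp: sets_restrict_space_iff)
    then have "A \<times> B \<in> sets (lborel \<Otimes>\<^sub>M lborel)" by (intro pair_measureI)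
    then have "A \<times> B \<in> sets borel" by (simp only: lborel_prod sets_lborel)
    then show ?thesis using * UV by (auto simp: sets_restrict_space_iff)
  qed
  show "sets (vol U \<Otimes>\<^sub>M vol V) = sets (vol (U \<times> V))"
  proof
    have "{a \<times> b |a b. a \<in> sets (vol U) \<and> b \<in> sets (vol V)} \<subseteq> sets (vol (U \<times> V))"
      using rect by auto
    from sets.sigma_sets_subset[OF this] show "sets (vol U \<Otimes>\<^sub>M vol V) \<subseteq> sets (vol (U \<times> V))"
      by (simp add: sets_pair_measure space_restrict_space)
  next
    have "(\<lambda>x. x) \<in> vol U \<rightarrow>\<^sub>M lborel" "(\<lambda>x. x) \<in> vol V \<rightarrow>\<^sub>M lborel"
      by (auto intro!: measurable_restrict_space1)
    from measurable_Pair[OF measurable_compose[OF measurable_fst this(1)] measurable_compose[OF measurable_snd this(2)]]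
    have id: "(\<lambda>x. x) \<in> vol U \<Otimes>\<^sub>M vol V \<rightarrow>\<^sub>M lborel"
      by (simp only: lborel_prod prod.collapse)
    show "sets (vol (U \<times> V)) \<subseteq> sets (vol U \<Otimes>\<^sub>M vol V)"
    proof
      fix E assume "E \<in> sets (vol (U \<times> V))"
      then have "E \<subseteq> U \<times> V" "E \<in> sets lborel" using UV by (auto simp: sets_restrict_space_iff)
      with measurable_sets[OF id, of E] show "E \<in> sets (vol U \<Otimes>\<^sub>M vol V)"
        by (simp add: space_pair_measure space_restrict_space Int_absorb2)
    qed
  qed
  fix A B assume AB: "A \<in> sets (vol U)" "B \<in> sets (vol V)"
  then have *: "A \<subseteq> U" "B \<subseteq> V" "A \<in> sets lborel" "B \<in> sets lborel"
    using U V by (auto simp: sets_restrict_space_iff)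
  then have "emeasure (vol U) A * emeasure (vol V) B = emeasure (lborel \<Otimes>\<^sub>M lborel) (A \<times> B)"
    using U V by (simp add: emeasure_restrict_space lborel.emeasure_pair_measure_Times)
  also have "\<dots> = emeasure (vol (U \<times> V)) (A \<times> B)"
    using * UV unfolding lborel_prod by (subst emeasure_restrict_space) auto
  finally show "emeasure (vol U) A * emeasure (vol V) B = emeasure (vol (U \<times> V)) (A \<times> B)" .
qed

lemma finite_measure_vol:
  assumes [measurable]: "U \<in> sets borel" and "bounded U"
  shows "finite_measure (vol U)"
  using emeasure_bounded_finite[OF assms(2)]
  by (intro finite_measureI) (simp add: space_restrict_space emeasure_restrict_space)

lemma lp_eq_Lp: "lp p U = Lp p (vol U)"
proof -
  have "integrable (vol U) (\<lambda>z. norm (f z) powr p) \<longleftrightarrow> pint p (vol U) f < \<infinity>"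
    if [measurable]: "f \<in> borel_measurable (vol U)" for f :: "'a \<Rightarrow> complex"
    unfolding integrable_iff_bounded pint_def by simp
  then show ?thesis by (auto simp: lp_def Lp_def)
qed

section \<open>Test functions and their barred derivatives\<close>

lemma test_function_has_derivative:
  assumes "test_function U \<phi>"
  shows "(\<phi> has_derivative frechet_derivative \<phi> (at x)) (at x)"
proof -
  have "ck (Suc 0) \<phi>" using assms by (simp only: test_function_def)
  then show ?thesis unfolding frechet_derivative_works[symmetric] differentiable_def by auto
qed

lemma dbar_eq:
  assumes "(\<phi> has_derivative D) (at x)"
  shows "dbar \<iota> \<phi> x = (D (\<iota> 1) + \<i> * D (\<iota> \<i>)) / 2"
  using frechet_derivative_at[OF assms] by (simp add: dbar_def)

lemma continuous_test_function: "test_function U \<phi> \<Longrightarrow> continuous_on UNIV \<phi>"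
  by (auto simp: test_function_def intro: ck_continuous)

lemma continuous_dbar_test_function:
  assumes "test_function U \<phi>"
  shows "continuous_on UNIV (dbar \<iota> \<phi>)"
proof -
  have "ck (Suc 0) \<phi>" using assms by (simp only: test_function_def)
  then obtain f' where f': "\<And>x. (\<phi> has_derivative f' x) (at x)" "\<And>v. continuous_on UNIV (\<lambda>x. f' x v)"
    by auto
  have "dbar \<iota> \<phi> = (\<lambda>x. (f' x (\<iota> 1) + \<i> * f' x (\<iota> \<i>)) / 2)"
    using dbar_eq[OF f'(1)] by auto
  then show ?thesis by (auto intro!: continuous_intros f')
qed

lemma bounded_compact_support:
  fixes f :: "'a::topological_space \<Rightarrow> complex"
  assumes "continuous_on UNIV f" "compact K" "\<And>x. x \<notin> K \<Longrightarrow> f x = 0"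
  obtains B where "\<And>x. norm (f x) \<le> B"
proof -
  have "bounded (f ` K)"
    using assms by (intro compact_imp_bounded compact_continuous_image) (auto intro: continuous_on_subset)
  then obtain B where B: "\<And>x. x \<in> K \<Longrightarrow> norm (f x) \<le> B" by (auto simp: bounded_iff)
  have "norm (f x) \<le> max B 0" for x
    using B[of x] assms(3)[of x] by (cases "x \<in> K") auto
  then show ?thesis by (rule that)
qed

text \<open>Off its compact support a test function is locally 0, so its derivative vanishes there
  too; both are continuous with support in the same compact set.\<close>

lemma test_function_bounded:
  assumes "test_function U \<phi>"
  obtains B where "\<And>x. norm (\<phi> x) \<le> B" "\<And>x. norm (dbar \<iota> \<phi> x) \<le> B"
proof -
  obtain K where K: "compact K" "\<And>x. x \<notin> K \<Longrightarrow> \<phi> x = 0"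
    using assms by (auto simp: test_function_def)
  have "dbar \<iota> \<phi> x = 0" if "x \<notin> K" for x
  proof -
    have "(\<phi> has_derivative (\<lambda>_. 0)) (at x)"
      by (rule has_derivative_transform_within_open[OF has_derivative_const[of 0], of "- K"])
         (use K that in \<open>auto simp: open_Compl compact_imp_closed\<close>)
    then show ?thesis by (simp add: dbar_eq)
  qed
  then obtain B1 where B1: "\<And>x. norm (dbar \<iota> \<phi> x) \<le> B1"
    using bounded_compact_support[OF continuous_dbar_test_function[OF assms] K(1)] by metis
  obtain B2 where B2: "\<And>x. norm (\<phi> x) \<le> B2"
    using bounded_compact_support[OF continuous_test_function[OF assms] K] by metis
  show ?thesis
    using B1 B2 by (intro that[of "max B1 B2"]) (auto simp: le_max_iff_disj)
qed

lemma test_function_tensor: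
  fixes \<psi> :: "'a::euclidean_space \<Rightarrow> complex" and \<eta> :: "'b::euclidean_space \<Rightarrow> complex"
  assumes \<psi>: "test_function U \<psi>" and \<eta>: "test_function V \<eta>"
  shows "test_function (U \<times> V) (\<lambda>x. \<psi> (fst x) * \<eta> (snd x))"
    and "dbar (\<lambda>c. (0, \<iota> c)) (\<lambda>x. \<psi> (fst x) * \<eta> (snd x)) x = \<psi> (fst x) * dbar \<iota> \<eta> (snd x)"
proof -
  obtain K L where K: "compact K" "K \<subseteq> U" "\<And>x. x \<notin> K \<Longrightarrow> \<psi> x = 0"
    and L: "compact L" "L \<subseteq> V" "\<And>x. x \<notin> L \<Longrightarrow> \<eta> x = 0"
    using \<psi> \<eta> by (auto simp: test_function_def)
  have supp: "\<psi> z \<noteq> 0 \<Longrightarrow> z \<in> K" "\<eta> w \<noteq> 0 \<Longrightarrow> w \<in> L" for z w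
    using K(3) L(3) by blast+
  have "ck k (\<lambda>x. \<psi> (fst x) * \<eta> (snd x))" for k
    using ck_compose_affine[OF bounded_linear_fst, of k \<psi> 0] ck_compose_affine[OF bounded_linear_snd, of k \<eta> 0] \<psi> \<eta>
    by (intro ck_mult) (auto simp: test_function_def)
  then show "test_function (U \<times> V) (\<lambda>x. \<psi> (fst x) * \<eta> (snd x))"
    unfolding test_function_def using K(1,2) L(1,2)
    by (intro conjI allI exI[of _ "K \<times> L"]) (auto intro: compact_Times supp)
  let ?D = "\<lambda>v. \<psi> (fst x) * frechet_derivative \<eta> (at (snd x)) (snd v) +
      frechet_derivative \<psi> (at (fst x)) (fst v) * \<eta> (snd x)"
  have der: "((\<lambda>x. \<psi> (fst x) * \<eta> (snd x)) has_derivative ?D) (at x)"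
    by (intro has_derivative_mult
        has_derivative_compose[OF has_derivative_fst[OF has_derivative_ident] test_function_has_derivative[OF \<psi>]]
        has_derivative_compose[OF has_derivative_snd[OF has_derivative_ident] test_function_has_derivative[OF \<eta>]])
  \<comment> \<open>The directions \<open>(0, \<iota> c)\<close> have first component 0, so the
    derivative of \<psi> enters only at the zero vector.\<close>
  have "frechet_derivative \<psi> (at (fst x)) 0 = 0"
    using test_function_has_derivative[OF \<psi>] by (simp add: has_derivative_def linear_simps)
  then show "dbar (\<lambda>c. (0, \<iota> c)) (\<lambda>x. \<psi> (fst x) * \<eta> (snd x)) x = \<psi> (fst x) * dbar \<iota> \<eta> (snd x)"
    by (subst dbar_eq[OF der]) (simp add: dbar_def algebra_simps add_divide_distrib)
qed

lemma test_function_slice: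
  fixes \<phi> :: "'a::euclidean_space \<times> 'b::euclidean_space \<Rightarrow> complex"
  assumes \<phi>: "test_function (U \<times> V) \<phi>"
  shows "test_function V (\<lambda>w. \<phi> (z, w))"
    and "dbar \<iota> (\<lambda>w. \<phi> (z, w)) w = dbar (\<lambda>c. (0, \<iota> c)) \<phi> (z, w)"
proof -
  obtain K where K: "compact K" "K \<subseteq> U \<times> V" "\<And>x. x \<notin> K \<Longrightarrow> \<phi> x = 0"
    using \<phi> by (auto simp: test_function_def)
  have L: "bounded_linear (\<lambda>w::'b. (0::'a, w))"
    by (intro bounded_linear_Pair bounded_linear_zero bounded_linear_ident)
  have "ck k (\<lambda>w. \<phi> (z, w))" for k
    using ck_compose_affine[OF L, of k \<phi> "(z, 0)"] \<phi> by (simp add: test_function_def)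
  moreover have "compact (snd ` K)"
    by (intro compact_continuous_image K continuous_intros)
  moreover have "\<phi> (z, w) = 0" if "w \<notin> snd ` K" for w
    using K(3)[of "(z, w)"] that by force
  ultimately show "test_function V (\<lambda>w. \<phi> (z, w))"
    unfolding test_function_def using K(2) by (intro conjI allI exI[of _ "snd ` K"]) auto
  have "((\<lambda>w. (z, w)) has_derivative (\<lambda>v. (0, v))) (at w)"
    by (auto intro!: derivative_eq_intros)
  from has_derivative_compose[OF this test_function_has_derivative[OF \<phi>]]
  show "dbar \<iota> (\<lambda>w. \<phi> (z, w)) w = dbar (\<lambda>c. (0, \<iota> c)) \<phi> (z, w)"
    by (subst dbar_eq) (auto simp: dbar_def)
qed

lemma borel_measurable_vol_continuous:
  fixes f :: "'a::euclidean_space \<Rightarrow> complex"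
  shows "continuous_on UNIV f \<Longrightarrow> f \<in> borel_measurable (vol U)"
  by (intro measurable_restrict_space1) (simp add: borel_measurable_continuous_onI)

lemma integrable_mult_bounded:
  fixes f h :: "'a \<Rightarrow> complex"
  assumes f: "integrable M f" and h: "h \<in> borel_measurable M" and B: "\<And>x. norm (h x) \<le> B"
  shows "integrable M (\<lambda>x. f x * h x)"
proof (rule Bochner_Integration.integrable_bound[of M "\<lambda>x. of_real B * f x"])
  have "norm (h x) * norm (f x) \<le> \<bar>B\<bar> * norm (f x)" for x
    using B[of x] by (intro mult_right_mono) auto
  then show "AE x in M. norm (f x * h x) \<le> norm (of_real B * f x)"
    by (simp add: norm_mult mult.commute)
qed (use f h in auto)

section \<open>Commutation with the barred derivative for scalar functions on open sets\<close>

locale domain_pair = bounded_Lp_operator_pair "vol U" "vol V" p S C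
  for U :: "'a::euclidean_space set" and V :: "'b::euclidean_space set" and p S C +
  assumes U: "open U" and V: "open V"
begin

lemma pair_eq: "vol U \<Otimes>\<^sub>M vol V = vol (U \<times> V)"
  using U V by (intro vol_pair M.finite_measure_axioms N.finite_measure_axioms) auto

lemma bounded_weight_test:
  assumes "test_function V \<eta>"
  shows "bounded_weight \<eta>" "bounded_weight (dbar \<iota> \<eta>)"
proof -
  obtain B where "\<And>x. norm (\<eta> x) \<le> B" "\<And>x. norm (dbar \<iota> \<eta> x) \<le> B"
    using test_function_bounded[OF assms] by metis
  then show "bounded_weight \<eta>" "bounded_weight (dbar \<iota> \<eta>)"
    using borel_measurable_vol_continuous continuous_test_function[OF assms]
      continuous_dbar_test_function[OF assms]
    unfolding bounded_weight_def by blast+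
qed

lemma integral_avg_mult:
  assumes f: "f \<in> Lp p (vol (U \<times> V))" and \<eta>: "bounded_weight \<eta>" and \<psi>: "test_function U \<psi>"
  shows "(LINT z|vol U. avg \<eta> f z * \<psi> z) = (LINT x|vol (U \<times> V). f x * (\<psi> (fst x) * \<eta> (snd x)))"
    and "integrable (vol (U \<times> V)) (\<lambda>x. f x * (\<psi> (fst x) * \<eta> (snd x)))"
    and "integrable (vol U) (\<lambda>z. avg \<eta> f z * \<psi> z)"
proof -
  obtain B1 where B1: "\<And>z. norm (\<psi> z) \<le> B1" using test_function_bounded[OF \<psi>] by metis
  obtain B2 where B2: "\<And>w. norm (\<eta> w) \<le> B2" using \<eta> by (auto simp: bounded_weight_def)
  have B: "norm (\<psi> z * \<eta> w) \<le> B1 * B2" for z w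
    unfolding norm_mult by (intro mult_mono B1 B2 norm_ge_zero) (rule order_trans[OF norm_ge_zero B1])
  note [measurable] = bounded_weight_measurable[OF \<eta>]
    borel_measurable_vol_continuous[OF continuous_test_function[OF \<psi>], of U]
  have f': "f \<in> Lp p (vol U \<Otimes>\<^sub>M vol V)" using f by (simp add: pair_eq)
  have int: "integrable (vol U \<Otimes>\<^sub>M vol V) (\<lambda>x. f x * (\<psi> (fst x) * \<eta> (snd x)))"
    using B by (intro integrable_mult_bounded[where B="B1 * B2"] MN.Lp_integrable[OF f' p_ge(2)]) auto
  have eq: "(\<integral>w. f (z, w) * (\<psi> (fst (z, w)) * \<eta> (snd (z, w))) \<partial>vol V) = avg \<eta> f z * \<psi> z" for z
    unfolding avg_def by (simp flip: integral_mult_right_zero integral_mult_left_zero add: mult_ac)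
  show "integrable (vol (U \<times> V)) (\<lambda>x. f x * (\<psi> (fst x) * \<eta> (snd x)))"
    using int by (simp add: pair_eq)
  show "(LINT z|vol U. avg \<eta> f z * \<psi> z) = (LINT x|vol (U \<times> V). f x * (\<psi> (fst x) * \<eta> (snd x)))"
    using MN.integral_fst'[OF int] unfolding eq by (simp add: pair_eq)
  show "integrable (vol U) (\<lambda>z. avg \<eta> f z * \<psi> z)"
    using MN.integrable_fst'[OF int] unfolding eq .
qed

text \<open>Testing with \<psi> \<eta> and applying Fubini shows that the sum of the two averages is
  orthogonal to every \<psi>. The exceptional null set depends on \<eta>.\<close>

lemma weak_dbar_avg:
  assumes g: "g \<in> Lp p (vol (U \<times> V))" and g': "g' \<in> Lp p (vol (U \<times> V))"
    and weak: "weak_dbar (U \<times> V) (\<lambda>c. (0, \<iota> c)) g g'" and \<eta>: "test_function V \<eta>"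
  shows "AE z in vol U. avg (dbar \<iota> \<eta>) g z = - avg \<eta> g' z"
proof -
  let ?G = "\<lambda>z. avg (dbar \<iota> \<eta>) g z + avg \<eta> g' z"
  note w = bounded_weight_test[OF \<eta>]
  have "AE z in vol U. ?G z = 0"
  proof (rule AE_eq_0_if_test_integrals[OF U])
    show "integrable (vol U) ?G"
      using g g' by (intro Bochner_Integration.integrable_add M.Lp_integrable[OF _ p_ge(2)] avg_Lp w) (auto simp: pair_eq)
    fix \<psi> assume \<psi>: "test_function U \<psi>"
    have "(LINT z|vol U. ?G z * \<psi> z) =
        (LINT z|vol U. avg (dbar \<iota> \<eta>) g z * \<psi> z) + (LINT z|vol U. avg \<eta> g' z * \<psi> z)"
      using integral_avg_mult(3)[OF g w(2) \<psi>] integral_avg_mult(3)[OF g' w(1) \<psi>]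
      by (simp add: distrib_right)
    also have "\<dots> = 0"
      using weak[unfolded weak_dbar_def, rule_format, OF test_function_tensor(1)[OF \<psi> \<eta>]]
      unfolding test_function_tensor(2)[OF \<psi> \<eta>] integral_avg_mult(1)[OF g w(2) \<psi>] integral_avg_mult(1)[OF g' w(1) \<psi>]
      by simp
    finally show "(LINT z|vol U. ?G z * \<psi> z) = 0" .
  qed
  then show ?thesis by eventually_elim (simp add: add_eq_0_iff2)
qed

lemma acts_avg:
  assumes g: "g \<in> Lp p (vol (U \<times> V))" and g': "g' \<in> Lp p (vol (U \<times> V))"
    and weak: "weak_dbar (U \<times> V) (\<lambda>c. (0, \<iota> c)) g g'" and \<eta>: "test_function V \<eta>"
    and u: "acts g u" and v: "acts g' v"
  shows "AE z in vol U. avg (dbar \<iota> \<eta>) u z = - avg \<eta> v z"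
proof -
  note w = bounded_weight_test[OF \<eta>]
  have gg': "g \<in> Lp p (vol U \<Otimes>\<^sub>M vol V)" "g' \<in> Lp p (vol U \<Otimes>\<^sub>M vol V)"
    using g g' by (simp_all add: pair_eq)
  have "AE z in vol U. S (avg (dbar \<iota> \<eta>) g) z = S (\<lambda>z. (-1) * avg \<eta> g' z) z"
    using weak_dbar_avg[OF g g' weak \<eta>] by (intro S_cong avg_Lp Lp_cmult gg' w) simp
  with S_cmult[OF avg_Lp[OF gg'(2) w(1)], of "-1"] S_avg[OF gg'(1) u w(2)[of \<iota>]] S_avg[OF gg'(2) v w(1)]
  show ?thesis by eventually_elim simp
qed

text \<open>
  Only tensor products were tested so far.  For a general test function \<open>\<phi>\<close> the slices
  \<open>\<phi> (q, -)\<close> with \<open>q\<close> in a countable dense set are test functions on \<open>V\<close>; almost every \<open>z\<close>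
  works for all of them, and \<open>q\<close> may then tend to \<open>z\<close>.
\<close>

lemma acts_avg_slice:
  assumes g: "g \<in> Lp p (vol (U \<times> V))" and g': "g' \<in> Lp p (vol (U \<times> V))"
    and weak: "weak_dbar (U \<times> V) (\<lambda>c. (0, \<iota> c)) g g'" and \<phi>: "test_function (U \<times> V) \<phi>"
    and u: "acts g u" and v: "acts g' v"
  shows "AE z in vol U. (LINT w|vol V. u (z, w) * dbar (\<lambda>c. (0, \<iota> c)) \<phi> (z, w)) = - (LINT w|vol V. v (z, w) * \<phi> (z, w))"
proof -
  let ?d = "dbar (\<lambda>c. (0, \<iota> c)) \<phi>"
  \<comment> \<open>\<open>Q\<close> is dense in the whole space rather than in \<open>U\<close>:
    \<open>test_function_slice\<close> admits every q, the slice being 0 for q outside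
    \<open>U\<close>.\<close>
  obtain Q :: "'a set" where Q: "countable Q" "\<And>X. open X \<Longrightarrow> X \<noteq> {} \<Longrightarrow> \<exists>q\<in>Q. q \<in> X"
    using countable_dense_setE by blast
  obtain B where B: "\<And>x. norm (\<phi> x) \<le> B" "\<And>x. norm (?d x) \<le> B"
    using test_function_bounded[OF \<phi>] by metis
  have cont: "continuous_on UNIV \<phi>" "continuous_on UNIV ?d"
    using continuous_test_function[OF \<phi>] continuous_dbar_test_function[OF \<phi>] by auto
  have "AE z in vol U. \<forall>q\<in>Q. avg (dbar \<iota> (\<lambda>w. \<phi> (q, w))) u z = - avg (\<lambda>w. \<phi> (q, w)) v z"
    using Q(1) by (subst AE_ball_countable) (auto intro!: acts_avg[OF g g' weak _ u v] test_function_slice(1)[OF \<phi>])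
  then have AE_Q: "AE z in vol U. \<forall>q\<in>Q. (LINT w|vol V. u (z, w) * ?d (q, w)) = - (LINT w|vol V. v (z, w) * \<phi> (q, w))"
    by (simp add: avg_def test_function_slice(2)[OF \<phi>])
  \<comment> \<open>Only the weight moves with n while the slice f stays fixed. Its integrability
    and the uniform bound B justify the limit under the integral, and u and v need no continuity in
    z.\<close>
  have lim: "(\<lambda>n. LINT w|vol V. f w * h (q n, w)) \<longlonglongrightarrow> (LINT w|vol V. f w * h (z, w))"
    if f: "integrable (vol V) f" and h: "continuous_on UNIV h" "\<And>x. norm (h x) \<le> B" and q: "q \<longlonglongrightarrow> z"
    for f :: "'b \<Rightarrow> complex" and h :: "'a \<times> 'b \<Rightarrow> complex" and q z
  proof (rule integral_dominated_convergence[where w="\<lambda>w. B * norm (f w)"])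
    have [measurable]: "(\<lambda>w. h (z, w)) \<in> borel_measurable (vol V)" for z
      by (intro borel_measurable_vol_continuous continuous_on_compose2[OF h(1)] continuous_intros) auto
    show "(\<lambda>w. f w * h (z, w)) \<in> borel_measurable (vol V)"
      "(\<lambda>w. f w * h (q n, w)) \<in> borel_measurable (vol V)" for n
      using borel_measurable_integrable[OF f] by measurable
    show "AE w in vol V. (\<lambda>n. f w * h (q n, w)) \<longlonglongrightarrow> f w * h (z, w)"
      by (intro AE_I2 tendsto_mult tendsto_const continuous_on_tendsto_compose[OF h(1)] tendsto_Pair q) auto
    show "AE w in vol V. norm (f w * h (q n, w)) \<le> B * norm (f w)" for n
      using mult_right_mono[OF h(2) norm_ge_zero]
      by (intro AE_I2) (simp add: norm_mult mult.commute[of "norm (f _)"])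
  qed (use f in auto)
  have uv: "u \<in> Lp p (vol U \<Otimes>\<^sub>M vol V)" "v \<in> Lp p (vol U \<Otimes>\<^sub>M vol V)" using u v by (auto simp: acts_def)
  have "AE z in vol U. integrable (vol V) (\<lambda>w. u (z, w))" "AE z in vol U. integrable (vol V) (\<lambda>w. v (z, w))"
    using uv by (intro MN.AE_integrable_fst' MN.Lp_integrable[OF _ p_ge(2)]; simp)+
  with AE_Q show ?thesis
  proof eventually_elim
    case (elim z)
    have "z \<in> closure Q"
      using Q(2) by (auto simp: closure_iff_nhds_not_empty)
    then obtain q where q: "\<And>n. q n \<in> Q" "q \<longlonglongrightarrow> z" by (auto simp: closure_sequential)
    have "(\<lambda>n. - (LINT w|vol V. v (z, w) * \<phi> (q n, w))) \<longlonglongrightarrow> (LINT w|vol V. u (z, w) * ?d (z, w))"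
      using lim[OF elim(2) cont(2) B(2) q(2)] elim(1) q(1) by simp
    moreover have "(\<lambda>n. - (LINT w|vol V. v (z, w) * \<phi> (q n, w))) \<longlonglongrightarrow> - (LINT w|vol V. v (z, w) * \<phi> (z, w))"
      by (intro tendsto_minus lim elim cont B q)
    ultimately show ?case by (rule LIMSEQ_unique)
  qed
qed

lemma weak_dbar_acts:
  assumes g: "g \<in> Lp p (vol (U \<times> V))" and g': "g' \<in> Lp p (vol (U \<times> V))"
    and weak: "weak_dbar (U \<times> V) (\<lambda>c. (0, \<iota> c)) g g'" and u: "acts g u" and v: "acts g' v"
  shows "weak_dbar (U \<times> V) (\<lambda>c. (0, \<iota> c)) u v"
  unfolding weak_dbar_def
proof (intro allI impI)
  fix \<phi> assume \<phi>: "test_function (U \<times> V) \<phi>"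
  let ?d = "dbar (\<lambda>c. (0, \<iota> c)) \<phi>"
  obtain B where B: "\<And>x. norm (\<phi> x) \<le> B" "\<And>x. norm (?d x) \<le> B"
    using test_function_bounded[OF \<phi>] by metis
  have uv: "u \<in> Lp p (vol U \<Otimes>\<^sub>M vol V)" "v \<in> Lp p (vol U \<Otimes>\<^sub>M vol V)" using u v by (auto simp: acts_def)
  have meas: "\<phi> \<in> borel_measurable (vol U \<Otimes>\<^sub>M vol V)" "?d \<in> borel_measurable (vol U \<Otimes>\<^sub>M vol V)"
    unfolding pair_eq
    using continuous_test_function[OF \<phi>] continuous_dbar_test_function[OF \<phi>]
    by (auto intro: borel_measurable_vol_continuous)
  have int: "integrable (vol U \<Otimes>\<^sub>M vol V) (\<lambda>x. u x * ?d x)" "integrable (vol U \<Otimes>\<^sub>M vol V) (\<lambda>x. v x * \<phi> x)"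
    by (intro integrable_mult_bounded[OF _ _ B(2)] integrable_mult_bounded[OF _ _ B(1)]
        MN.Lp_integrable[OF _ p_ge(2)] uv meas)+
  have "(LINT x|vol (U \<times> V). u x * ?d x) = (LINT z|vol U. LINT w|vol V. u (z, w) * ?d (z, w))"
    using MN.integral_fst'[OF int(1)] by (simp add: pair_eq)
  also have "\<dots> = (LINT z|vol U. - (LINT w|vol V. v (z, w) * \<phi> (z, w)))"
    using acts_avg_slice[OF g g' weak \<phi> u v] MN.integrable_fst'[OF int(1)] MN.integrable_fst'[OF int(2)]
    by (intro integral_cong_AE) (auto dest: borel_measurable_integrable)
  also have "\<dots> = - (LINT x|vol (U \<times> V). v x * \<phi> x)"
    using MN.integral_fst'[OF int(2)] by (simp add: pair_eq)
  finally show "(LINT x|vol (U \<times> V). u x * ?d x) = - (LINT x|vol (U \<times> V). v x * \<phi> x)" .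
qed

end

section \<open>The operator \<open>T - P \<circ> T\<close>\<close>

lemma norm_axis_eq: "norm (axis m x :: 'b::real_normed_vector^'n) = norm x"
proof -
  have "(\<Sum>i\<in>UNIV. (norm ((axis m x :: 'b^'n) $ i))\<^sup>2) = (\<Sum>i\<in>UNIV. if i = m then (norm x)\<^sup>2 else 0)"
    by (rule sum.cong) (auto simp: axis_def)
  then show ?thesis by (simp add: norm_vec_def L2_set_def)
qed

lemma sum_axis_nth: "(\<Sum>m\<in>UNIV. axis m (v $ m)) = (v :: complex^'n)"
  by (simp add: vec_eq_iff axis_def)

lemma continuous_on_axis: "continuous_on UNIV (axis m :: complex \<Rightarrow> complex^'n)"
  unfolding axis_def[abs_def]
proof (rule continuous_on_vec_lambda)
  show "continuous_on UNIV (\<lambda>x::complex. if i = m then x else 0)" for i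
    by (cases "i = m") auto
qed

text \<open>\<open>lp_norm\<close> would take the default value 0 on a non-integrable integrand;
  this gives it its meaning for forms. The norm of a vector is at most \<open>CARD('n)\<close> times
  its largest coefficient, whose p-th power is dominated by the sum over all coefficients.\<close>

lemma lp_form_integrable:
  fixes f :: "'a::euclidean_space \<Rightarrow> complex^'n"
  assumes f: "f \<in> lp_form p U" and p: "0 \<le> p"
  shows "integrable (vol U) (\<lambda>z. norm (f z) powr p)"
proof -
  have comp: "(\<lambda>z. f z $ m) \<in> borel_measurable (vol U)" "integrable (vol U) (\<lambda>z. norm (f z $ m) powr p)" for m
    using f by (auto simp: lp_form_def lp_def)
  have [measurable]: "f \<in> borel_measurable (vol U)"
  proof -
    have "(\<lambda>z. \<Sum>m\<in>UNIV. axis m (f z $ m)) \<in> borel_measurable (vol U)"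
      by (intro borel_measurable_sum measurable_compose[OF comp(1)]
          borel_measurable_continuous_onI[OF continuous_on_axis])
    then show ?thesis by (simp add: sum_axis_nth)
  qed
  have "norm (f z) powr p \<le> (\<Sum>m\<in>UNIV. (real CARD('n)) powr p * norm (f z $ m) powr p)" for z
  proof -
    obtain m where m: "\<And>i. norm (f z $ i) \<le> norm (f z $ m)"
    proof -
      have "Max (range (\<lambda>i. norm (f z $ i))) \<in> range (\<lambda>i. norm (f z $ i))" by (intro Max_in) auto
      then obtain m where "Max (range (\<lambda>i. norm (f z $ i))) = norm (f z $ m)" by (metis imageE)
      then show thesis using that[of m] by (metis Max_ge finite finite_imageI rangeI)
    qed
    have "norm (f z) \<le> (\<Sum>i\<in>UNIV. norm (f z $ i))"
      unfolding norm_vec_def by (intro L2_set_le_sum) auto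
    also have "\<dots> \<le> (\<Sum>i\<in>(UNIV :: 'n set). norm (f z $ m))"
      by (intro sum_mono m)
    finally have "norm (f z) \<le> real CARD('n) * norm (f z $ m)" by simp
    then have "norm (f z) powr p \<le> (real CARD('n) * norm (f z $ m)) powr p"
      using p by (intro powr_mono2) auto
    also have "\<dots> = real CARD('n) powr p * norm (f z $ m) powr p"
      by (simp add: powr_mult)
    also have "\<dots> \<le> (\<Sum>m\<in>UNIV. (real CARD('n)) powr p * norm (f z $ m) powr p)"
      by (rule member_le_sum) auto
    finally show ?thesis .
  qed
  then have bound: "AE z in vol U. norm (norm (f z) powr p) \<le> norm (\<Sum>m\<in>UNIV. (real CARD('n)) powr p * norm (f z $ m) powr p)"
    by (intro AE_I2) (simp, meson abs_ge_self order_trans)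
  have int: "integrable (vol U) (\<lambda>z. \<Sum>m\<in>UNIV. (real CARD('n)) powr p * norm (f z $ m) powr p)"
    by (intro Bochner_Integration.integrable_sum integrable_mult_right comp)
  have "(\<lambda>z. norm (f z) powr p) \<in> borel_measurable (vol U)" by measurable
  from Bochner_Integration.integrable_bound[OF int this bound] show ?thesis .
qed

lemma pint_eq_lp_norm:
  assumes "integrable (vol U) (\<lambda>z. norm (f z) powr p)" "0 < p"
  shows "pint p (vol U) f = ennreal (lp_norm p U f powr p)"
proof -
  have "lp_norm p U f powr p = (LINT z|vol U. norm (f z) powr p)"
    using assms(2) unfolding lp_norm_def powr_powr by simp
  moreover have "pint p (vol U) f = ennreal (LINT z|vol U. norm (f z) powr p)"
    unfolding pint_def by (rule nn_integral_eq_integral[OF assms(1)]) simp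
  ultimately show ?thesis by simp
qed

lemma bounded_lp_operator_pint:
  assumes T: "bounded_lp_operator p U X smul T" and p: "0 < p"
    and X: "\<And>f. f \<in> X \<Longrightarrow> integrable (vol U) (\<lambda>z. norm (f z) powr p)"
  obtains C :: real where "\<And>f. f \<in> X \<Longrightarrow> pint p (vol U) (T f) \<le> ennreal C * pint p (vol U) f"
proof -
  obtain C where C: "\<And>f. f \<in> X \<Longrightarrow> lp_norm p U (T f) \<le> C * lp_norm p U f"
    using T unfolding bounded_lp_operator_def by blast
  show ?thesis
  proof (rule that)
    fix f assume f: "f \<in> X"
    have norm_nonneg: "0 \<le> lp_norm p U f" "0 \<le> lp_norm p U (T f)" by (simp_all add: lp_norm_def)
    \<comment> \<open>The constant may be negative, so it is truncated at 0 before p-th powers are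
      taken.\<close>
    have "lp_norm p U (T f) \<le> max C 0 * lp_norm p U f"
      using C[OF f] norm_nonneg by (meson max.cobounded1 mult_right_mono order_trans)
    then have "lp_norm p U (T f) powr p \<le> (max C 0 * lp_norm p U f) powr p"
      using p norm_nonneg by (intro powr_mono2) auto
    also have "\<dots> = max C 0 powr p * lp_norm p U f powr p"
      using norm_nonneg by (simp add: powr_mult)
    finally have "ennreal (lp_norm p U (T f) powr p) \<le> ennreal (max C 0 powr p) * ennreal (lp_norm p U f powr p)"
      by (simp add: ennreal_leI flip: ennreal_mult)
    moreover have "T f \<in> lp p U"
      using T f by (auto simp: bounded_lp_operator_def)
    ultimately show "pint p (vol U) (T f) \<le> ennreal (max C 0 powr p) * pint p (vol U) f"
      using p X[OF f] by (simp add: pint_eq_lp_norm lp_def)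
  qed
qed

text \<open>
  Same content as \<open>bounded_lp_operator\<close> for forms, with the bound stated for the integral of the
  \<open>p\<close>-th power, so that no Minkowski inequality is needed for sums of operators.
\<close>

definition bounded_form_operator :: "real \<Rightarrow> 'a::euclidean_space set \<Rightarrow> (('a \<Rightarrow> complex^'n) \<Rightarrow> 'a \<Rightarrow> complex) \<Rightarrow> bool" where
  "bounded_form_operator p U S \<longleftrightarrow>
     (\<forall>f\<in>lp_form p U. S f \<in> lp p U) \<and>
     (\<forall>f\<in>lp_form p U. \<forall>g\<in>lp_form p U. ae_eq U (S (\<lambda>z. f z + g z)) (\<lambda>z. S f z + S g z)) \<and>
     (\<forall>c. \<forall>f\<in>lp_form p U. ae_eq U (S (\<lambda>z. c *s f z)) (\<lambda>z. c * S f z)) \<and>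
     (\<exists>C::real. \<forall>f\<in>lp_form p U. pint p (vol U) (S f) \<le> ennreal C * pint p (vol U) f)"

lemma lp_form_add: "f \<in> lp_form p U \<Longrightarrow> g \<in> lp_form p U \<Longrightarrow> 0 \<le> p \<Longrightarrow> (\<lambda>z. f z + g z) \<in> lp_form p U"
  by (auto simp: lp_form_def lp_eq_Lp intro: Lp_add)

lemma lp_form_cmult: "f \<in> lp_form p U \<Longrightarrow> (\<lambda>z. c *s f z) \<in> lp_form p U"
  by (auto simp: lp_form_def lp_eq_Lp intro: Lp_cmult)

lemma bounded_form_operator_diff_compose:
  assumes T: "bounded_lp_operator p U (lp_form p U) (*s) T"
    and P: "bounded_lp_operator p U (lp p U) (*) P" and p: "0 < p"
  shows "bounded_form_operator p U (\<lambda>\<alpha> z. T \<alpha> z - P (T \<alpha>) z)"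
proof -
  have T_lp: "T f \<in> lp p U" if "f \<in> lp_form p U" for f
    using T that by (auto simp: bounded_lp_operator_def)
  have P_lp: "P f \<in> lp p U" if "f \<in> lp p U" for f
    using P that by (auto simp: bounded_lp_operator_def)
  have P_cong: "ae_eq U (P f) (P g)" if "f \<in> lp p U" "g \<in> lp p U" "ae_eq U f g" for f g
    using P that by (auto simp: bounded_lp_operator_def)
  obtain C1 where C1: "\<And>f. f \<in> lp_form p U \<Longrightarrow> pint p (vol U) (T f) \<le> ennreal C1 * pint p (vol U) f"
    using bounded_lp_operator_pint[OF T p lp_form_integrable] p by (metis less_imp_le)
  obtain C2 where C2: "\<And>f. f \<in> lp p U \<Longrightarrow> pint p (vol U) (P f) \<le> ennreal C2 * pint p (vol U) f"
    using bounded_lp_operator_pint[OF P p] unfolding lp_def by blast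
  show ?thesis
    unfolding bounded_form_operator_def
  proof (intro conjI ballI allI)
    fix f :: "'a \<Rightarrow> complex^'b" assume f: "f \<in> lp_form p U"
    show "(\<lambda>z. T f z - P (T f) z) \<in> lp p U"
      using T_lp[OF f] P_lp[OF T_lp[OF f]] p by (simp add: lp_eq_Lp Lp_diff)
    fix g :: "'a \<Rightarrow> complex^'b" assume g: "g \<in> lp_form p U"
    have T_add: "ae_eq U (T (\<lambda>z. f z + g z)) (\<lambda>z. T f z + T g z)"
      using T f g by (auto simp: bounded_lp_operator_def)
    \<comment> \<open>Additivity of \<open>T\<close> holds only almost everywhere, so
      \<open>P\<close> has to respect a.e. equality before its own additivity applies.\<close>
    have "ae_eq U (P (T (\<lambda>z. f z + g z))) (P (\<lambda>z. T f z + T g z))"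
      using T_lp[OF f] T_lp[OF g] p lp_form_add[OF f g]
      by (intro P_cong T_add) (auto simp: lp_eq_Lp intro: Lp_add T_lp[unfolded lp_eq_Lp])
    moreover have "ae_eq U (P (\<lambda>z. T f z + T g z)) (\<lambda>z. P (T f) z + P (T g) z)"
      using P T_lp[OF f] T_lp[OF g] by (auto simp: bounded_lp_operator_def)
    ultimately show "ae_eq U (\<lambda>z. T (\<lambda>z. f z + g z) z - P (T (\<lambda>z. f z + g z)) z)
        (\<lambda>z. T f z - P (T f) z + (T g z - P (T g) z))"
      using T_add unfolding ae_eq_def by eventually_elim simp
  next
    fix c and f :: "'a \<Rightarrow> complex^'b" assume f: "f \<in> lp_form p U"
    have T_cmult: "ae_eq U (T (\<lambda>z. c *s f z)) (\<lambda>z. c * T f z)"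
      using T f by (auto simp: bounded_lp_operator_def)
    have "ae_eq U (P (T (\<lambda>z. c *s f z))) (P (\<lambda>z. c * T f z))"
      using T_lp[OF f] lp_form_cmult[OF f]
      by (intro P_cong T_cmult) (auto simp: lp_eq_Lp intro: Lp_cmult T_lp[unfolded lp_eq_Lp])
    moreover have "ae_eq U (P (\<lambda>z. c * T f z)) (\<lambda>z. c * P (T f) z)"
      using P T_lp[OF f] by (auto simp: bounded_lp_operator_def)
    ultimately show "ae_eq U (\<lambda>z. T (\<lambda>z. c *s f z) z - P (T (\<lambda>z. c *s f z)) z) (\<lambda>z. c * (T f z - P (T f) z))"
      using T_cmult unfolding ae_eq_def by eventually_elim (simp add: algebra_simps)
  next
    \<comment> \<open>The factor \<open>2 powr p\<close> comes from \<open>pint_diff\<close>, the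
      two summands bound \<open>T\<close> and \<open>P\<close> after \<open>T\<close>.\<close>
    let ?C = "2 powr p * (\<bar>C1\<bar> + \<bar>C2\<bar> * \<bar>C1\<bar>)"
    show "\<exists>C::real. \<forall>f\<in>lp_form p U. pint p (vol U) (\<lambda>z. T f z - P (T f) z) \<le> ennreal C * pint p (vol U) f"
    proof (intro exI[of _ ?C] ballI)
      fix f :: "'a \<Rightarrow> complex^'b" assume f: "f \<in> lp_form p U"
      have Tf: "pint p (vol U) (T f) \<le> ennreal \<bar>C1\<bar> * pint p (vol U) f"
        by (rule order_trans[OF C1[OF f]]) (auto intro!: mult_right_mono ennreal_leI)
      have "pint p (vol U) (P (T f)) \<le> ennreal \<bar>C2\<bar> * pint p (vol U) (T f)"
        by (rule order_trans[OF C2[OF T_lp[OF f]]]) (auto intro!: mult_right_mono ennreal_leI)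
      also have "\<dots> \<le> ennreal \<bar>C2\<bar> * (ennreal \<bar>C1\<bar> * pint p (vol U) f)"
        by (intro mult_left_mono Tf) auto
      finally have PTf: "pint p (vol U) (P (T f)) \<le> ennreal (\<bar>C2\<bar> * \<bar>C1\<bar>) * pint p (vol U) f"
        by (simp add: ennreal_mult mult.assoc)
      have "pint p (vol U) (\<lambda>z. T f z - P (T f) z) \<le> ennreal (2 powr p) * (pint p (vol U) (T f) + pint p (vol U) (P (T f)))"
        using T_lp[OF f] P_lp[OF T_lp[OF f]] p by (intro pint_diff) (auto simp: lp_def)
      also have "\<dots> \<le> ennreal (2 powr p) * (ennreal \<bar>C1\<bar> * pint p (vol U) f + ennreal (\<bar>C2\<bar> * \<bar>C1\<bar>) * pint p (vol U) f)"
        by (intro mult_left_mono add_mono Tf PTf) auto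
      also have "\<dots> = ennreal ?C * pint p (vol U) f"
        by (simp add: ennreal_mult ennreal_plus distrib_right distrib_left mult.assoc)
      finally show "pint p (vol U) (\<lambda>z. T f z - P (T f) z) \<le> ennreal ?C * pint p (vol U) f" .
    qed
  qed
qed

section \<open>Reduction of forms to their coefficients\<close>

lemma axis_lp_form:
  assumes "h \<in> lp p U" "0 < p"
  shows "(\<lambda>z. axis m (h z)) \<in> lp_form p U"
proof -
  have "(\<lambda>z. 0) \<in> lp p U" using assms(2) by (simp add: lp_def)
  then have "(\<lambda>z. axis m (h z) $ j) \<in> lp p U" for j
    using assms(1) by (cases "j = m") (auto simp: axis_def)
  then show ?thesis by (simp add: lp_form_def)
qed

lemma pint_axis: "pint p M (\<lambda>z. axis m (h z) :: complex^'n) = pint p M h"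
  by (simp add: pint_def norm_axis_eq)

lemma bounded_form_operator_commutes:
  fixes U :: "(complex^'n) set" and V :: "(complex^'m) set"
  assumes S: "bounded_form_operator p U S" and p: "1 < p"
    and U: "open U" "bounded U" and V: "open V" "bounded V"
  shows "commutes_with_dbar p U V i S"
proof -
  \<comment> \<open>The scalar operator sending h to \<open>S\<close> of h times the m-th conjugate
    differential. As \<open>axis m\<close> preserves norms, each \<open>Sm m\<close> inherits the
    constant of \<open>S\<close>.\<close>
  define Sm where "Sm m h = S (\<lambda>z. axis m (h z))" for m h
  obtain C where C: "\<And>f. f \<in> lp_form p U \<Longrightarrow> pint p (vol U) (S f) \<le> ennreal C * pint p (vol U) f"
    using S unfolding bounded_form_operator_def by blast
  have form_add: "ae_eq U (S (\<lambda>z. f z + g z)) (\<lambda>z. S f z + S g z)" if "f \<in> lp_form p U" "g \<in> lp_form p U" for f g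
    using S that by (auto simp: bounded_form_operator_def)
  have form_cmult: "ae_eq U (S (\<lambda>z. c *s f z)) (\<lambda>z. c * S f z)" if "f \<in> lp_form p U" for c f
    using S that by (auto simp: bounded_form_operator_def)
  have pair: "domain_pair U V p (Sm m) C" for m
  proof (intro domain_pair.intro bounded_Lp_operator_pair.intro bounded_Lp_operator_pair_axioms.intro domain_pair_axioms.intro)
    show "finite_measure (vol U)" "finite_measure (vol V)"
      using U V by (auto intro: finite_measure_vol)
    fix f g c assume f: "f \<in> Lp p (vol U)"
    then have f': "(\<lambda>z. axis m (f z)) \<in> lp_form p U" using p by (intro axis_lp_form) (auto simp: lp_eq_Lp)
    show "Sm m f \<in> Lp p (vol U)"
      using S f' by (auto simp: Sm_def bounded_form_operator_def lp_eq_Lp)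
    show "pint p (vol U) (Sm m f) \<le> ennreal C * pint p (vol U) f"
      using C[OF f'] by (simp add: Sm_def pint_axis)
    have "axis m (c * f z) = c *s axis m (f z)" for z by (simp add: vec_eq_iff axis_def)
    then show "AE z in vol U. Sm m (\<lambda>z. c * f z) z = c * Sm m f z"
      using form_cmult[OF f', of c] by (simp add: Sm_def ae_eq_def)
    assume "g \<in> Lp p (vol U)"
    then have g': "(\<lambda>z. axis m (g z)) \<in> lp_form p U" using p by (intro axis_lp_form) (auto simp: lp_eq_Lp)
    have "axis m (f z + g z) = axis m (f z) + axis m (g z)" for z by (simp add: vec_eq_iff axis_def)
    then show "AE z in vol U. Sm m (\<lambda>z. f z + g z) z = Sm m f z + Sm m g z"
      using form_add[OF f' g'] by (simp add: Sm_def ae_eq_def)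
  qed (use p U V in auto)
  interpret domain_pair U V p "Sm m" C for m by (rule pair)
  have S_sum: "AE z in vol U. S f z = (\<Sum>m\<in>UNIV. Sm m (\<lambda>z. f z $ m) z)" if f: "f \<in> lp_form p U" for f
  proof -
    have ax: "(\<lambda>z. axis m (f z $ m)) \<in> lp_form p U" for m
      using f p by (intro axis_lp_form) (auto simp: lp_form_def)
    have "(\<lambda>z. \<Sum>m\<in>I. axis m (f z $ m)) \<in> lp_form p U \<and>
        (AE z in vol U. S (\<lambda>z. \<Sum>m\<in>I. axis m (f z $ m)) z = (\<Sum>m\<in>I. Sm m (\<lambda>z. f z $ m) z))" if "finite I" for I
      using that
    proof (induction I rule: finite_induct)
      case empty
      \<comment> \<open>Homogeneity with c = 0 gives that \<open>S\<close> of the zero form vanishes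
        a.e.\<close>
      have 0: "(\<lambda>z. 0) \<in> lp_form p U" using p by (simp add: lp_form_def lp_def)
      then show ?case using form_cmult[OF 0, of 0] by (simp add: ae_eq_def)
    next
      case (insert m I)
      then show ?case
        using form_add[OF ax[of m], of "\<lambda>z. \<Sum>m\<in>I. axis m (f z $ m)"] lp_form_add[OF ax[of m], of "\<lambda>z. \<Sum>m\<in>I. axis m (f z $ m)"] p
        by (auto simp: Sm_def ae_eq_def elim!: eventually_elim2)
    qed
    from this[of UNIV] show ?thesis by (simp add: sum_axis_nth)
  qed
  have slices: "AE w in vol V. (\<lambda>z. g (z, w)) \<in> lp_form p U" if g: "g \<in> lp_form p (U \<times> V)" for g :: "_ \<Rightarrow> complex^'n"
  proof -
    have "AE w in vol V. \<forall>m\<in>UNIV. (\<lambda>z. g (z, w) $ m) \<in> Lp p (vol U)"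
      using g by (subst AE_ball_countable) (auto simp: lp_form_def lp_eq_Lp pair_eq intro!: Lp_slice)
    then show ?thesis by (simp add: lp_form_def lp_eq_Lp)
  qed
  \<comment> \<open>The coefficientwise results add up to a result for the form, and every other
    result agrees with it a.e.; arbitrary u and v can later be replaced by such sums.\<close>
  have ex: "\<exists>u'. (\<forall>m. acts m (\<lambda>x. g x $ m) (u' m)) \<and> acts_fibrewise p U V S g (\<lambda>x. \<Sum>m\<in>UNIV. u' m x) \<and>
      (\<forall>u. acts_fibrewise p U V S g u \<longrightarrow> (AE x in vol (U \<times> V). u x = (\<Sum>m\<in>UNIV. u' m x)))"
    if g: "g \<in> lp_form p (U \<times> V)" for g
  proof -
    have "\<forall>m. \<exists>u. acts m (\<lambda>x. g x $ m) u"
      using g by (intro allI acts_exists) (auto simp: lp_form_def lp_eq_Lp pair_eq)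
    then obtain u' where u': "\<And>m. acts m (\<lambda>x. g x $ m) (u' m)" by metis
    have u'_Lp: "u' m \<in> lp p (U \<times> V)" for m
      using u'[of m] by (simp add: acts_def lp_eq_Lp pair_eq)
    let ?u = "\<lambda>x. \<Sum>m\<in>UNIV. u' m x"
    have u_lp: "?u \<in> lp p (U \<times> V)"
      using u'_Lp p unfolding lp_eq_Lp by (intro Lp_sum) auto
    have "AE w in vol V. \<forall>m\<in>UNIV. AE z in vol U. u' m (z, w) = Sm m (\<lambda>z. g (z, w) $ m) z"
      using u' by (subst AE_ball_countable) (auto simp: acts_def elim!: eventually_mono)
    with slices[OF g] have fib: "AE w in vol V. (\<lambda>z. g (z, w)) \<in> lp_form p U \<and> ae_eq U (\<lambda>z. ?u (z, w)) (S (\<lambda>z. g (z, w)))"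
    proof eventually_elim
      case (elim w)
      have "AE z in vol U. \<forall>m\<in>UNIV. u' m (z, w) = Sm m (\<lambda>z. g (z, w) $ m) z"
        using elim(2) by (subst AE_ball_countable) auto
      with S_sum[OF elim(1)] have "AE z in vol U. ?u (z, w) = S (\<lambda>z. g (z, w)) z"
        by eventually_elim simp
      then show ?case using elim(1) by (simp add: ae_eq_def)
    qed
    have uniq: "AE x in vol (U \<times> V). u x = ?u x" if u: "acts_fibrewise p U V S g u" for u
    proof -
      have [measurable]: "u \<in> borel_measurable (vol U \<Otimes>\<^sub>M vol V)" "?u \<in> borel_measurable (vol U \<Otimes>\<^sub>M vol V)"
        using u u_lp by (auto simp: acts_fibrewise_def lp_def pair_eq)
      \<comment> \<open>The fibrewise condition gives null sets in z for almost every w. Exchanging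
        the quantifiers, as \<open>AE_pair_measure\<close> requires, rests on the joint
        measurability of u.\<close>
      have "AE w in vol V. AE z in vol U. u (z, w) = ?u (z, w)"
        using u[unfolded acts_fibrewise_def, THEN conjunct2] fib
        by eventually_elim (auto simp: ae_eq_def elim!: eventually_elim2)
      then have "AE z in vol U. AE w in vol V. u (z, w) = ?u (z, w)"
        by (subst MN.AE_commute) auto
      then have "AE x in vol U \<Otimes>\<^sub>M vol V. u x = ?u x"
        by (intro MN.AE_pair_measure) auto
      then show ?thesis by (simp only: pair_eq)
    qed
    show ?thesis
      using u' u_lp fib uniq by (intro exI[of _ u']) (auto simp: acts_fibrewise_def)
  qed
  show ?thesis
    unfolding commutes_with_dbar_def
  proof (intro ballI impI conjI allI)
    fix g g' assume g: "g \<in> lp_form p (U \<times> V)" and g': "g' \<in> lp_form p (U \<times> V)"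
      and weak: "(\<forall>m. weak_dbar (U \<times> V) (\<lambda>c. (0, axis i c)) (\<lambda>x. g x $ m) (\<lambda>x. g' x $ m)) \<and>
        weakly_closed (U \<times> V) (\<lambda>m c. (axis m c, 0)) g"
    show "\<exists>u. acts_fibrewise p U V S g u" "\<exists>v. acts_fibrewise p U V S g' v"
      using ex[OF g] ex[OF g'] by auto
    fix u v assume uv: "acts_fibrewise p U V S g u \<and> acts_fibrewise p U V S g' v"
    obtain u' where u': "\<And>m. acts m (\<lambda>x. g x $ m) (u' m)" "AE x in vol (U \<times> V). u x = (\<Sum>m\<in>UNIV. u' m x)"
      using ex[OF g] uv by blast
    obtain v' where v': "\<And>m. acts m (\<lambda>x. g' x $ m) (v' m)" "AE x in vol (U \<times> V). v x = (\<Sum>m\<in>UNIV. v' m x)"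
      using ex[OF g'] uv by blast
    have weak': "weak_dbar (U \<times> V) (\<lambda>c. (0, axis i c)) (u' m) (v' m)" for m
    proof -
      have "(\<lambda>x. g x $ m) \<in> Lp p (vol (U \<times> V))" "(\<lambda>x. g' x $ m) \<in> Lp p (vol (U \<times> V))"
        using g g' by (simp_all add: lp_form_def lp_eq_Lp)
      from weak_dbar_acts[OF this weak[THEN conjunct1, rule_format] u'(1) v'(1)] show ?thesis .
    qed
    have int: "integrable (vol (U \<times> V)) (u' m)" "integrable (vol (U \<times> V)) (v' m)" for m
    proof -
      have "u' m \<in> Lp p (vol U \<Otimes>\<^sub>M vol V)" "v' m \<in> Lp p (vol U \<Otimes>\<^sub>M vol V)"
        using u'(1)[of m] v'(1)[of m] by (simp_all add: acts_def)
      from this[THEN MN.Lp_integrable, OF p_ge(2)]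
      show "integrable (vol (U \<times> V)) (u' m)" "integrable (vol (U \<times> V)) (v' m)"
        by (simp_all only: pair_eq)
    qed
    show "weak_dbar (U \<times> V) (\<lambda>c. (0, axis i c)) u v"
      unfolding weak_dbar_def
    proof (intro allI impI)
      fix \<phi> assume \<phi>: "test_function (U \<times> V) \<phi>"
      let ?d = "dbar (\<lambda>c. (0, axis i c)) \<phi>"
      obtain B where B: "\<And>x. norm (\<phi> x) \<le> B" "\<And>x. norm (?d x) \<le> B"
        using test_function_bounded[OF \<phi>] by metis
      have meas [measurable]: "\<phi> \<in> borel_measurable (vol (U \<times> V))" "?d \<in> borel_measurable (vol (U \<times> V))"
        by (intro borel_measurable_vol_continuous continuous_test_function[OF \<phi>] continuous_dbar_test_function[OF \<phi>])+
      have int': "integrable (vol (U \<times> V)) (\<lambda>x. u' m x * ?d x)" "integrable (vol (U \<times> V)) (\<lambda>x. v' m x * \<phi> x)" for m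
        using integrable_mult_bounded[OF int(1) meas(2) B(2)] integrable_mult_bounded[OF int(2) meas(1) B(1)] by auto
      have [measurable]: "u \<in> borel_measurable (vol (U \<times> V))" "v \<in> borel_measurable (vol (U \<times> V))"
        "u' m \<in> borel_measurable (vol (U \<times> V))" "v' m \<in> borel_measurable (vol (U \<times> V))" for m
        using uv int[of m] by (auto simp: acts_fibrewise_def lp_def)
      \<comment> \<open>Integrals ignore null sets, so u and v become sums over m, for which the
        identity holds term by term.\<close>
      have "(LINT x|vol (U \<times> V). u x * ?d x) = (LINT x|vol (U \<times> V). (\<Sum>m\<in>UNIV. u' m x * ?d x))"
        using u'(2) by (intro integral_cong_AE) (auto simp: sum_distrib_right)
      also have "\<dots> = (\<Sum>m\<in>UNIV. (LINT x|vol (U \<times> V). u' m x * ?d x))"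
        by (intro Bochner_Integration.integral_sum int')
      also have "\<dots> = (\<Sum>m\<in>UNIV. - (LINT x|vol (U \<times> V). v' m x * \<phi> x))"
        using weak' \<phi> by (intro sum.cong refl) (auto simp: weak_dbar_def)
      also have "\<dots> = - (LINT x|vol (U \<times> V). (\<Sum>m\<in>UNIV. v' m x * \<phi> x))"
        by (simp add: sum_negf Bochner_Integration.integral_sum[OF int'(2)])
      also have "(LINT x|vol (U \<times> V). (\<Sum>m\<in>UNIV. v' m x * \<phi> x)) = (LINT x|vol (U \<times> V). v x * \<phi> x)"
        using v'(2) by (intro integral_cong_AE) (auto simp: sum_distrib_right)
      finally show "(LINT x|vol (U \<times> V). u x * ?d x) = - (LINT x|vol (U \<times> V). v x * \<phi> x)" .
    qed
  qed
qed

section \<open>The parameter domain as a product of blocks\<close>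

lemma open_block_product:
  assumes "finite J" "\<And>j. j \<in> J \<Longrightarrow> openin (top_of_set (block_space blk j)) (Ds j)"
  shows "open (block_product blk J Ds)"
proof -
  have "open {w. block_proj blk j w \<in> Ds j}" if j: "j \<in> J" for j
  proof -
    obtain X where X: "open X" "Ds j = block_space blk j \<inter> X"
      using assms(2)[OF j] by (auto simp: openin_open)
    \<comment> \<open>The factor is open only relative to its block. Since the projection lands in
      that block, the preimage of the factor is the preimage of an open set of the whole
      space.\<close>
    have "block_proj blk j w \<in> block_space blk j" for w
      by (simp add: block_proj_def block_space_def)
    then have "{w. block_proj blk j w \<in> Ds j} = block_proj blk j -` X"
      using X by auto
    moreover have "continuous_on UNIV (block_proj blk j)"
      unfolding block_proj_def[abs_def]
    proof (rule continuous_on_vec_lambda)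
      show "continuous_on UNIV (\<lambda>w. if blk i = j then w $ i else 0)" for i
        by (cases "blk i = j") (auto intro!: continuous_intros)
    qed
    ultimately show ?thesis using X(1) by (simp add: open_vimage)
  qed
  moreover have "block_product blk J Ds = (\<Inter>j\<in>J. {w. block_proj blk j w \<in> Ds j})"
    by (auto simp: block_product_def)
  ultimately show ?thesis using assms(1) by (simp add: open_INT)
qed

text \<open>Each coordinate belongs to a block with index in \<open>J\<close>, and the bound of that
  factor controls it; the sum over coordinates bounds the norm.\<close>

lemma bounded_block_product:
  fixes blk :: "'m::finite \<Rightarrow> nat"
  assumes "range blk \<subseteq> J" "\<And>j. j \<in> J \<Longrightarrow> bounded (Ds j)"
  shows "bounded (block_product blk J Ds)"
proof -
  obtain B where B: "\<And>j w. j \<in> J \<Longrightarrow> w \<in> Ds j \<Longrightarrow> norm w \<le> B j"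
    using assms(2) unfolding bounded_iff by metis
  have "norm w \<le> (\<Sum>i\<in>UNIV. B (blk i))" if w: "w \<in> block_product blk J Ds" for w
  proof -
    have "norm w \<le> (\<Sum>i\<in>UNIV. norm (w $ i))"
      unfolding norm_vec_def by (intro L2_set_le_sum) auto
    also have "\<dots> \<le> (\<Sum>i\<in>UNIV. B (blk i))"
    proof (rule sum_mono)
      fix i
      have j: "blk i \<in> J" using assms(1) by auto
      have "norm (w $ i) = norm (block_proj blk (blk i) w $ i)" by (simp add: block_proj_def)
      also have "\<dots> \<le> norm (block_proj blk (blk i) w)" by (rule Finite_Cartesian_Product.norm_nth_le)
      also have "\<dots> \<le> B (blk i)" using w j by (intro B) (auto simp: block_product_def)
      finally show "norm (w $ i) \<le> B (blk i)" .
    qed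
    finally show ?thesis .
  qed
  then show ?thesis by (auto simp: bounded_iff)
qed

theorem proposition0p6:
  fixes D1 :: "(complex^'n) set"
    and k :: nat
    and blk :: "'m::finite \<Rightarrow> nat"
    and Ds :: "nat \<Rightarrow> (complex^'m) set"
    and p :: real
    and T :: "(complex^'n \<Rightarrow> complex^'n) \<Rightarrow> complex^'n \<Rightarrow> complex"
    and P :: "(complex^'n \<Rightarrow> complex) \<Rightarrow> complex^'n \<Rightarrow> complex"
  assumes D1: "bounded_domain_in UNIV D1"
    and blk: "range blk = {2..k}"
    and Ds: "\<And>j. j \<in> {2..k} \<Longrightarrow> bounded_domain_in (block_space blk j) (Ds j)"
    and p: "1 < p"
    and T_bounded: "bounded_lp_operator p D1 (lp_form p D1) (*s) T"
    and T_solves: "solves_dbar p D1 T"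
    and P_bounded: "bounded_lp_operator p D1 (lp p D1) (*) P"
    and P_into: "\<And>f. f \<in> lp p D1 \<Longrightarrow> P f \<in> bergman p D1"
    and P_preserves: "\<And>h. h \<in> bergman p D1 \<Longrightarrow> ae_eq D1 (P h) h"
  shows "\<forall>i. commutes_with_dbar p D1 (block_product blk {2..k} Ds) i (\<lambda>\<alpha> z. T \<alpha> z - P (T \<alpha>) z)"
proof
  fix i
  show "commutes_with_dbar p D1 (block_product blk {2..k} Ds) i (\<lambda>\<alpha> z. T \<alpha> z - P (T \<alpha>) z)"
  proof (rule bounded_form_operator_commutes[OF _ p])
    show "bounded_form_operator p D1 (\<lambda>\<alpha> z. T \<alpha> z - P (T \<alpha>) z)"
      using p by (intro bounded_form_operator_diff_compose T_bounded P_bounded) auto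
    show "open D1" "bounded D1"
      using D1 by (auto simp: bounded_domain_in_def)
    show "open (block_product blk {2..k} Ds)" "bounded (block_product blk {2..k} Ds)"
      using Ds blk by (auto intro!: open_block_product bounded_block_product simp: bounded_domain_in_def)
  qed
qed

end
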